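(* Let $V\in\mathcal P^{s,p}_q(\mathbb R^n)$ and $g\in W^{s,p}(\mathbb R^n)$, where $q>\frac{n}{ps}>1$, $p>1$, $s\in(0,1)$, and let $B_{2r}(x_0)\subset\Omega$. If $u\in\mathrm Y^{s,p}_g(\Omega)^-$ is a weak subsolution of the nonlocal equation $\mathrm L^p_K u+V|u|^{p-2}u=0$ in $\Omega$, $u=g$ in $\mathbb R^n\setminus\Omega$, then for any nonnegative $\zeta\in C_c^\infty(B_r(x_0))$, writing $B=B_r(x_0)$, $$\begin{aligned}&\int_{B}[w(y)\zeta(y)]^pV(y)\,dy+\iint_{B\times B}|\zeta(x)w(x)-\zeta(y)w(y)|^p\,d_K(x,y)\\&\quad\le2^{2p+1}\bigl(\tfrac14+c_p\bigr)\iint_{B\times B}[\max\{w(x),w(y)\}]^p|\zeta(x)-\zeta(y)|^p\,d_K(x,y)\\&\qquad+2^{p+2}\left(\sup_{x\in\operatorname{supp}(\zeta)}\int_{\mathbb R^n\setminus B}w^{p-1}(y)K(x-y)\,dy\right)\|w\zeta^p\|_{L^1(B)},\end{aligned}$$ where $w=(u-M)_+$ for $M\in(0,\infty)$ and $c_p=\frac12[2(p-1)]^{p-1}$.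
   Context: Throughout, $\Omega\subset\mathbb R^n$ is a bounded domain with Lipschitz boundary, $f_+=\max\{f,0\}$, $f_-=\max\{-f,0\}$, and $B_r(x_0)$ is the ball of radius $r$ centered at $x_0$. Kernel and operator: $K$ is a positive kernel with $\frac{c_{n,p,s}\lambda}{|y|^{n+ps}}\le K(y)=K(-y)\le\frac{c_{n,p,s}\Lambda}{|y|^{n+ps}}$ for $y\in\mathbb R^n\setminus\{0\}$, where $0<\lambda\le\Lambda$ and $c_{n,p,s}=\frac{\Gamma(\frac{n+p}{2})\,p\,(1-s)}{\pi^{(n-1)/2}\Gamma(\frac{p+1}{2})}$. Set $H_p(t)=|t|^{p-2}t$, $d_K(x,y)=K(x-y)\,dx\,dy$, and $\mathrm L^p_Ku(x)=\mathrm{p.v.}\int_{\mathbb R^n}H_p(u(x)-u(y))K(x-y)\,dy$. Weights: a weight is a locally integrable function on $\mathbb R^n$ with values in $[0,\infty)$ a.e. A pair of weights $(\upsilon,\omega)$ is in the $(A_1,A_1)$-Muckenhoupt class if $\sup_Q\left(\frac1{|Q|}\int_Q\upsilon\,dy\right)\|\omega^{-1}\|_{L^\infty(Q)}<\infty$ (supremum over all cubes $Q\subset\mathbb R^n$), and $\omega\in A_1$ if $(\omega,\omega)\in(A_1,A_1)$. Potentials: for $q>\frac n{ps}>1$, $\mathcal P^{s,p}_q(\mathbb R^n)$ is the class of all potentials $V=V_+-V_-$ such that (i) $V_-\in L^1_{\rm loc}(\mathbb R^n)$; (ii) $V_+\in L^q_{\rm loc}(\mathbb R^n)$; (iii) there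 is an a.e. positive bounded function $b$ on $\mathbb R^n$ such that $V_+/b\in L^q_{\rm loc}(\mathbb R^n)$ and, for all $i\in\mathbb N$, with $V_+^{b,i}:=\frac{\max\{b,1/i\}}{b}V_+$, one has $(V_-,V_+^{b,i})\in(A_1,A_1)$ and $V_+^{b,i}\in A_1$. Function spaces: $\mathrm X^{s,p}(\Omega)$ is the space of measurable $v:\mathbb R^n\to\mathbb R$ with $v|_\Omega\in L^p(\Omega)$ and $\iint_{\mathbb R^{2n}\setminus(\Omega^c\times\Omega^c)}\frac{|v(x)-v(y)|^p}{|x-y|^{n+ps}}dx\,dy<\infty$; $\mathrm X^{s,p}_0(\Omega)=\{v\in\mathrm X^{s,p}(\Omega):v=0\text{ a.e. in }\mathbb R^n\setminus\Omega\}$. $L^p_V(\Omega)$ is the class of measurable $u:\mathbb R^n\to\mathbb R$ with $\int_\Omega|u|^pV_+\,dy<\infty$ and $\int_\Omega|u|^pV_-\,dy<\infty$. $\mathrm Y^{s,p}(\Omega)=\mathrm X^{s,p}(\Omega)\cap L^p_V(\Omega)$, $\mathrm Y^{s,p}_0(\Omega)=\mathrm X^{s,p}_0(\Omega)\cap L^p_V(\Omega)$, $\mathrm Y^{s,p}_g(\Omega)^-=\{u\in\mathrm Y^{s,p}(\Omega):(g-u)_-\in\mathrm Y^{s,p}_0(\Omega)\}$. $W^{s,p}(\mathbb R^n)$ is the usual fractional Sobolev space. Weak subsolution: $u\in\mathrm Y^{s,p}_g(\Omega)^-$ is a weak subsolution if $$\iint_{\mathbb R^n\times\mathbb R^n}H_p(u(x)-u(y))(\varphi(x)-\varphi(y))\,d_K(x,y)+\int_{\mathbb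 R^n}V|u|^{p-2}u\,\varphi\,dx\le0$$ for all nonnegative $\varphi\in\mathrm Y^{s,p}_0(\Omega)$. *)

theory Defs
  imports "HOL-Probability.Essential_Supremum"
begin

text \<open>
  Conventions.  \<open>\<real>\<^sup>n\<close> is \<^typ>\<open>real ^ 'n\<close>.  Measurability is Lebesgue measurability; a double integral
  over \<open>\<real>\<^sup>n \<times> \<real>\<^sup>n\<close> is an integral against the Lebesgue measure of the product space.  Integrals of
  nonnegative functions that may diverge are taken in \<^typ>\<open>ennreal\<close>.
\<close>

subsection \<open>Domains\<close>

text \<open>
  Lipschitz boundary: near each boundary point the set is, after a choice of the vertical direction
  \<open>e\<close>, the open supergraph of a Lipschitz function \<open>\<gamma>\<close> of the component orthogonal to \<open>e\<close>.
\<close>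

definition lipschitz_boundary :: "(real ^ 'n) set \<Rightarrow> bool" where
  "lipschitz_boundary \<Omega> \<longleftrightarrow>
     (\<forall>z \<in> frontier \<Omega>. \<exists>\<rho>>0. \<exists>e. \<exists>\<gamma> :: real ^ 'n \<Rightarrow> real. \<exists>L.
        norm e = 1 \<and> L-lipschitz_on {y. y \<bullet> e = 0} \<gamma> \<and>
        \<Omega> \<inter> ball z \<rho> = {y \<in> ball z \<rho>. \<gamma> (y - (y \<bullet> e) *\<^sub>R e) < y \<bullet> e})"

definition bounded_lipschitz_domain :: "(real ^ 'n) set \<Rightarrow> bool" where
  "bounded_lipschitz_domain \<Omega> \<longleftrightarrow>
     open \<Omega> \<and> connected \<Omega> \<and> \<Omega> \<noteq> {} \<and> bounded \<Omega> \<and> lipschitz_boundary \<Omega>"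

subsection \<open>Kernels\<close>

definition kernel_const :: "nat \<Rightarrow> real \<Rightarrow> real \<Rightarrow> real" where
  "kernel_const n p s =
     Gamma ((real n + p) / 2) * p * (1 - s) / (pi powr ((real n - 1) / 2) * Gamma ((p + 1) / 2))"

text \<open>The value of the kernel at the origin is irrelevant and left unconstrained.\<close>

definition admissible_kernel :: "real \<Rightarrow> real \<Rightarrow> real \<Rightarrow> real \<Rightarrow> (real ^ 'n \<Rightarrow> real) \<Rightarrow> bool" where
  "admissible_kernel s p l L K \<longleftrightarrow>
     K \<in> borel_measurable lebesgue \<and>
     (\<forall>y. y \<noteq> 0 \<longrightarrow>
        0 < K y \<and>
        kernel_const CARD('n) p s * l / norm y powr (real CARD('n) + p * s) \<le> K y \<and>
        K y = K (- y) \<and>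
        K y \<le> kernel_const CARD('n) p s * L / norm y powr (real CARD('n) + p * s))"

definition Hp :: "real \<Rightarrow> real \<Rightarrow> real" where
  "Hp p t = \<bar>t\<bar> powr (p - 2) * t"

subsection \<open>Weights and potentials\<close>

definition pos_part :: "('a \<Rightarrow> real) \<Rightarrow> 'a \<Rightarrow> real" where
  "pos_part f x = max (f x) 0"

definition neg_part :: "('a \<Rightarrow> real) \<Rightarrow> 'a \<Rightarrow> real" where
  "neg_part f x = max (- f x) 0"

definition Lq_loc :: "real \<Rightarrow> (real ^ 'n \<Rightarrow> real) set" where
  "Lq_loc q = {f. f \<in> borel_measurable lebesgue \<and>
     (\<forall>C. compact C \<longrightarrow> (\<integral>\<^sup>+ y\<in>C. ennreal (\<bar>f y\<bar> powr q) \<partial>lebesgue) < \<infinity>)}"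

definition is_weight :: "(real ^ 'n \<Rightarrow> real) \<Rightarrow> bool" where
  "is_weight \<omega> \<longleftrightarrow> \<omega> \<in> Lq_loc 1 \<and> (AE y in lebesgue. 0 \<le> \<omega> y)"

definition cubes :: "(real ^ 'n) set set" where
  "cubes = {cbox a (\<chi> i. a $ i + h) | a h. 0 < h}"

text \<open>
  The inverse is taken in \<^typ>\<open>ennreal\<close>, so it is infinite where the weight vanishes (whereas
  \<open>1 / 0 = 0\<close> in \<^typ>\<open>real\<close>); a product of zero and infinity is zero.
\<close>

definition A1_pair :: "(real ^ 'n \<Rightarrow> real) \<Rightarrow> (real ^ 'n \<Rightarrow> real) \<Rightarrow> bool" where
  "A1_pair \<upsilon> \<omega> \<longleftrightarrow> is_weight \<upsilon> \<and> is_weight \<omega> \<and>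
     (SUP Q\<in>cubes. ((\<integral>\<^sup>+ y\<in>Q. ennreal (\<upsilon> y) \<partial>lebesgue) / emeasure lebesgue Q)
        * esssup (restrict_space lebesgue Q) (\<lambda>y. inverse (ennreal (\<omega> y)))) < \<infinity>"

definition A1 :: "(real ^ 'n \<Rightarrow> real) \<Rightarrow> bool" where
  "A1 \<omega> \<longleftrightarrow> A1_pair \<omega> \<omega>"

text \<open>The regularised positive part \<open>V\<^sub>+\<^sup>b\<^sup>,\<^sup>i\<close>, for \<open>i \<ge> 1\<close>.\<close>

definition pos_part_reg :: "(real ^ 'n \<Rightarrow> real) \<Rightarrow> (real ^ 'n \<Rightarrow> real) \<Rightarrow> nat \<Rightarrow> real ^ 'n \<Rightarrow> real" where
  "pos_part_reg V b i y = max (b y) (1 / real i) / b y * pos_part V y"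

definition potentials :: "real \<Rightarrow> (real ^ 'n \<Rightarrow> real) set" where
  "potentials q = {V.
     neg_part V \<in> Lq_loc 1 \<and>
     pos_part V \<in> Lq_loc q \<and>
     (\<exists>b. b \<in> borel_measurable lebesgue \<and> bounded (range b) \<and> (AE y in lebesgue. 0 < b y) \<and>
        (\<lambda>y. pos_part V y / b y) \<in> Lq_loc q \<and>
        (\<forall>i\<ge>1. A1_pair (neg_part V) (pos_part_reg V b i) \<and> A1 (pos_part_reg V b i)))}"

subsection \<open>Function spaces\<close>

definition Wsp :: "real \<Rightarrow> real \<Rightarrow> (real ^ 'n \<Rightarrow> real) set" where
  "Wsp s p = {v. v \<in> borel_measurable lebesgue \<and>
     (\<integral>\<^sup>+ x. ennreal (\<bar>v x\<bar> powr p) \<partial>lebesgue) < \<infinity> \<and>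
     (\<integral>\<^sup>+ (x, y). ennreal (\<bar>v x - v y\<bar> powr p / norm (x - y) powr (real CARD('n) + p * s))
        \<partial>lebesgue) < \<infinity>}"

definition Xsp :: "real \<Rightarrow> real \<Rightarrow> (real ^ 'n) set \<Rightarrow> (real ^ 'n \<Rightarrow> real) set" where
  "Xsp s p \<Omega> = {v. v \<in> borel_measurable lebesgue \<and>
     (\<integral>\<^sup>+ x\<in>\<Omega>. ennreal (\<bar>v x\<bar> powr p) \<partial>lebesgue) < \<infinity> \<and>
     (\<integral>\<^sup>+ z\<in>UNIV - (- \<Omega>) \<times> (- \<Omega>).
        ennreal (\<bar>v (fst z) - v (snd z)\<bar> powr p / norm (fst z - snd z) powr (real CARD('n) + p * s))
        \<partial>lebesgue) < \<infinity>}"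

definition Xsp0 :: "real \<Rightarrow> real \<Rightarrow> (real ^ 'n) set \<Rightarrow> (real ^ 'n \<Rightarrow> real) set" where
  "Xsp0 s p \<Omega> = {v \<in> Xsp s p \<Omega>. AE x in lebesgue. x \<notin> \<Omega> \<longrightarrow> v x = 0}"

definition LpV :: "real \<Rightarrow> (real ^ 'n \<Rightarrow> real) \<Rightarrow> (real ^ 'n) set \<Rightarrow> (real ^ 'n \<Rightarrow> real) set" where
  "LpV p V \<Omega> = {u. u \<in> borel_measurable lebesgue \<and>
     (\<integral>\<^sup>+ y\<in>\<Omega>. ennreal (\<bar>u y\<bar> powr p * pos_part V y) \<partial>lebesgue) < \<infinity> \<and>
     (\<integral>\<^sup>+ y\<in>\<Omega>. ennreal (\<bar>u y\<bar> powr p * neg_part V y) \<partial>lebesgue) < \<infinity>}"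

definition Ysp where
  "Ysp s p V \<Omega> = Xsp s p \<Omega> \<inter> LpV p V \<Omega>"

definition Ysp0 where
  "Ysp0 s p V \<Omega> = Xsp0 s p \<Omega> \<inter> LpV p V \<Omega>"

definition Yspg_minus where
  "Yspg_minus s p V \<Omega> g = {u \<in> Ysp s p V \<Omega>. neg_part (\<lambda>x. g x - u x) \<in> Ysp0 s p V \<Omega>}"

text \<open>
  Weak subsolutions of \<open>L\<^sup>p\<^sub>K u + V |u|\<^sup>p\<^sup>-\<^sup>2 u = 0\<close> in \<open>\<Omega>\<close>, \<open>u = g\<close> outside \<open>\<Omega>\<close>.  By Hoelder's inequality
  for an admissible kernel \<open>K\<close> and a potential \<open>V\<close>
  both integrands below are Lebesgue integrable for all \<open>u\<close> and \<open>\<phi>\<close> in the stated spaces, so the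
  convention that a non-integrable function has integral zero plays no role.
\<close>

definition weak_subsolution ::
  "real \<Rightarrow> real \<Rightarrow> (real ^ 'n \<Rightarrow> real) \<Rightarrow> (real ^ 'n \<Rightarrow> real) \<Rightarrow> (real ^ 'n) set \<Rightarrow>
   (real ^ 'n \<Rightarrow> real) \<Rightarrow> (real ^ 'n \<Rightarrow> real) \<Rightarrow> bool" where
  "weak_subsolution s p K V \<Omega> g u \<longleftrightarrow>
     u \<in> Yspg_minus s p V \<Omega> g \<and>
     (\<forall>\<phi> \<in> Ysp0 s p V \<Omega>. (\<forall>x. 0 \<le> \<phi> x) \<longrightarrow>
        (LINT (x, y)|lebesgue. Hp p (u x - u y) * (\<phi> x - \<phi> y) * K (x - y)) +
        (LINT x|lebesgue. V x * (\<bar>u x\<bar> powr (p - 2) * u x) * \<phi> x) \<le> 0)"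

subsection \<open>Test functions\<close>

text \<open>\<open>Ck k f\<close>: all partial derivatives of \<open>f\<close> up to order \<open>k\<close> exist and are continuous.\<close>

primrec Ck :: "nat \<Rightarrow> (real ^ 'n \<Rightarrow> real) \<Rightarrow> bool" where
  "Ck 0 f \<longleftrightarrow> continuous_on UNIV f"
| "Ck (Suc k) f \<longleftrightarrow> f differentiable_on UNIV \<and>
     (\<forall>i. Ck k (\<lambda>x. frechet_derivative f (at x) (axis i 1)))"

definition supp :: "(real ^ 'n \<Rightarrow> real) \<Rightarrow> (real ^ 'n) set" where
  "supp f = closure {x. f x \<noteq> 0}"

text \<open>Elements of \<open>C\<^sub>c\<^sup>\<infinity>(U)\<close> are extended by zero to the whole space.\<close>

definition Cc_infinity :: "(real ^ 'n) set \<Rightarrow> (real ^ 'n \<Rightarrow> real) set" where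
  "Cc_infinity U = {f. (\<forall>k. Ck k f) \<and> compact (supp f) \<and> supp f \<subseteq> U}"

end

theory Submission
  imports Defs
begin

text \<open>
  On \<open>{V\<^sub>- > 0}\<close> the weights \<open>V\<^sub>+\<^sup>b\<^sup>,\<^sup>i\<close> vanish, so the two-weight \<open>A\<^sub>1\<close> condition forces \<open>V\<^sub>- = 0\<close>
  almost everywhere.  Testing the subsolution inequality with \<open>\<phi> = w \<zeta>\<^sup>p\<close>, the potential term is
  therefore at least \<open>\<integral> V (w \<zeta>)\<^sup>p\<close>, because \<open>u \<ge> w\<close> where \<open>w > 0\<close>.  On \<open>B \<times> B\<close> the integrand of the
  nonlocal term is bounded below, by Young's inequality, by \<open>2\<^sup>-\<^sup>p\<^sup>-\<^sup>1 \<bar>\<zeta>(x) w(x) - \<zeta>(y) w(y)\<bar>\<^sup>p\<close> minus a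
  multiple of \<open>max (w(x)) (w(y))\<^sup>p \<bar>\<zeta>(x) - \<zeta>(y)\<bar>\<^sup>p\<close>.  For \<open>x \<in> B\<close> and \<open>y \<notin> B\<close> it is at least
  \<open>- w(y)\<^sup>p\<^sup>-\<^sup>1 w(x) \<zeta>(x)\<^sup>p\<close>, which Tonelli's theorem turns into the tail term.
\<close>

subsection \<open>Pointwise inequalities\<close>

text \<open>The tested inequality compares Bochner integrals, whereas the claim concerns integrals
  that may be infinite, so nothing may be subtracted before integrability is known. Hence the energy
  integrand \<open>E\<close> is shown to be integrable, and all estimates are collected in one
  pointwise bound \<open>D z \<le> \<mu> * E z + G z\<close> with nonnegative \<open>D\<close> and
  \<open>G\<close>; if the integral of \<open>G\<close> is infinite, nothing remains to be shown.
  Only the integral of \<open>E\<close> over all pairs is controlled, so one factor \<mu> must serve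
  inside \<open>B \<times> B\<close> and across its boundary. It is \<open>2 powr (p + 1)\<close>:
  \<open>2 powr p\<close> from the power of a sum, and 2 from absorbing half of the energy by
  Young's inequality. The test function is admissible because the p-th power of the cutoff is
  bounded and Lipschitz: its differences lead to the kernel min(\<Lambda>|h|, 2C)^p / |h|^(n+ps),
  which is integrable for 0 < s < 1.\<close>

lemma powr_minus_one_mult: "0 \<le> c \<Longrightarrow> c powr (p - 1) * c = c powr p" for c p :: real
  using powr_mult_base[of c "p - 1"] by (simp add: mult.commute)

lemma powr_Young:
  fixes a b p :: real
  assumes p: "1 < p" and "0 \<le> a" "0 \<le> b"
  shows "p * (a powr (p - 1) * b) \<le> (p - 1) * a powr p + b powr p"
proof -
  define q where "q = p / (p - 1)"
  have "b * a powr (p - 1) \<le> b powr p / p + (a powr (p - 1)) powr q / q"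
    by (rule Youngs_inequality) (use assms in \<open>auto simp: q_def field_simps\<close>)
  also have "(a powr (p - 1)) powr q = a powr p"
    using p by (simp add: q_def powr_powr)
  finally have "p * (b * a powr (p - 1)) \<le> p * (b powr p / p + a powr p / q)"
    using p by (intro mult_left_mono) auto
  also have "\<dots> = (p - 1) * a powr p + b powr p"
    using p by (simp add: q_def field_simps)
  finally show ?thesis by (simp add: mult_ac)
qed

text \<open>Convexity of the p-th power, read at its tangent in \<open>a\<close>. Since
  \<open>a powr (p - 1) * a = a powr p\<close>, it is Young's inequality rearranged, without
  differentiation.\<close>

lemma powr_diff_le:
  fixes a b p :: real
  assumes "1 < p" "0 \<le> a" "0 \<le> b"
  shows "a powr p - b powr p \<le> p * (a powr (p - 1) * (a - b))"
proof -
  have "a powr (p - 1) * a = a powr p"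
    using assms by (intro powr_minus_one_mult)
  then show ?thesis
    using powr_Young[OF assms] by (simp add: algebra_simps)
qed

text \<open>Replacing \<open>a\<close> by \<open>t * a\<close> and \<open>b\<close> by
  \<open>b / t powr (p - 1)\<close> leaves the product unchanged. The choice (p - 1) t^p = 1/2 makes
  the first term small enough to be absorbed; the price \<open>(2 * (p - 1)) powr (p - 1)\<close> is
  twice the constant \<open>c\<^sub>p\<close> of the theorem.\<close>

lemma powr_Young_half:
  fixes a b p :: real
  assumes p: "1 < p" and "0 \<le> a" "0 \<le> b"
  shows "p * (a powr (p - 1) * b) \<le> a powr p / 2 + (2 * (p - 1)) powr (p - 1) * b powr p"
proof -
  define t where "t = (2 * (p - 1)) powr (- 1 / p)"
  have t: "0 < t" using p by (simp add: t_def)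
  have "t powr p = (2 * (p - 1)) powr (- 1)"
    unfolding t_def powr_powr using p by simp
  also have "\<dots> = 1 / (2 * (p - 1))"
    using p by (simp add: powr_minus divide_inverse)
  finally have 1: "t powr p = 1 / (2 * (p - 1))" .
  have "p * ((t * a) powr (p - 1) * (b / t powr (p - 1)))
      \<le> (p - 1) * (t * a) powr p + (b / t powr (p - 1)) powr p"
    using assms t by (intro powr_Young) auto
  also have "(t * a) powr (p - 1) * (b / t powr (p - 1)) = a powr (p - 1) * b"
    using t assms by (simp add: powr_mult)
  also have "(p - 1) * (t * a) powr p = a powr p / 2"
    using t assms by (simp add: powr_mult 1 field_simps)
  also have "(b / t powr (p - 1)) powr p = (2 * (p - 1)) powr (p - 1) * b powr p"
  proof -
    have "(b / t powr (p - 1)) powr p = b powr p / (t powr p) powr (p - 1)"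
      using assms t by (simp add: powr_divide powr_powr mult.commute)
    also have "\<dots> = (2 * (p - 1)) powr (p - 1) * b powr p"
      unfolding 1 using p by (simp add: powr_divide)
    finally show ?thesis .
  qed
  finally show ?thesis .
qed

lemma powr_add_le:
  fixes a b p :: real
  assumes "0 \<le> p" "0 \<le> a" "0 \<le> b"
  shows "(a + b) powr p \<le> 2 powr p * (a powr p + b powr p)"
proof -
  have "(a + b) powr p \<le> (2 * max a b) powr p"
    using assms by (intro powr_mono2) auto
  also have "\<dots> = 2 powr p * max a b powr p"
    using assms by (simp add: powr_mult)
  also have "max a b powr p \<le> a powr p + b powr p"
    by (auto simp: max_def)
  finally show ?thesis by simp
qed

lemma powr_abs_le_add:
  fixes a b c p :: real
  assumes "0 \<le> p" "\<bar>c\<bar> \<le> a + b" "0 \<le> a" "0 \<le> b"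
  shows "\<bar>c\<bar> powr p \<le> 2 powr p * (a powr p + b powr p)"
proof -
  have "\<bar>c\<bar> powr p \<le> (a + b) powr p" using assms by (intro powr_mono2) auto
  also note powr_add_le[OF assms(1,3,4)]
  finally show ?thesis .
qed

lemma powr_mult_le_add:
  fixes a b p :: real
  assumes "1 \<le> p" "0 \<le> a" "0 \<le> b"
  shows "a powr (p - 1) * b \<le> a powr p + b powr p"
proof -
  have "a powr (p - 1) * b \<le> max a b powr (p - 1) * max a b"
    using assms by (intro mult_mono powr_mono2) auto
  also have "\<dots> = max a b powr p" using assms by (intro powr_minus_one_mult) auto
  also have "\<dots> \<le> a powr p + b powr p" by (auto simp: max_def)
  finally show ?thesis .
qed

section \<open>The nonlinearity and the pointwise energy estimates\<close>

lemma Hp_minus: "Hp p (- t) = - Hp p t"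
  by (simp add: Hp_def)

lemma Hp_nonneg_eq: "0 \<le> t \<Longrightarrow> Hp p t = t powr (p - 1)"
  using powr_minus_one_mult[of t "p - 1"] by (simp add: Hp_def)

lemma abs_Hp: "\<bar>Hp p t\<bar> = \<bar>t\<bar> powr (p - 1)"
  using Hp_nonneg_eq[of "\<bar>t\<bar>" p] by (simp add: Hp_def abs_mult)

text \<open>Here \<open>a\<close>, \<open>b\<close> stand for the values of the subsolution at two
  points and \<open>y\<close>, \<open>z\<close> for those of the cutoff. The order
  \<open>b \<le> a\<close> makes \<open>\<alpha> - \<beta>\<close> nonnegative, so the energy
  \<open>E\<close> of the truncations needs only plain powers. \<open>S\<close> measures the change
  of the truncation, \<open>R\<close> that of the cutoff; the bound rests on
  \<open>S \<le> 2 * E + 2 * C * R\<close> and on comparing \<open>E\<close> with the energy of the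
  untruncated values.\<close>

lemma caccioppoli_pointwise_ordered:
  fixes a b M y z p :: real
  defines "\<alpha> \<equiv> max (a - M) 0" and "\<beta> \<equiv> max (b - M) 0"
  assumes p: "1 < p" and ba: "b \<le> a" and z: "0 \<le> y" "0 \<le> z"
  shows "\<bar>y * \<alpha> - z * \<beta>\<bar> powr p
    \<le> 2 powr (p + 1) * (Hp p (a - b) * (\<alpha> * y powr p - \<beta> * z powr p)
        + (1 / 2 + (2 * (p - 1)) powr (p - 1)) * (max \<alpha> \<beta> powr p * \<bar>y - z\<bar> powr p))"
proof -
  define C where "C = (2 * (p - 1)) powr (p - 1)"
  have C: "0 \<le> C" by (simp add: C_def)
  have ab: "0 \<le> \<beta>" "\<beta> \<le> \<alpha>" "max \<alpha> \<beta> = \<alpha>" using ba by (auto simp: \<alpha>_def \<beta>_def)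
  define R where "R = \<alpha> powr p * \<bar>y - z\<bar> powr p"
  have R: "R = (\<alpha> * \<bar>y - z\<bar>) powr p" using ab by (simp add: R_def powr_mult)
  have R0: "0 \<le> R" by (simp add: R_def)
  define E where "E = (\<alpha> - \<beta>) powr (p - 1) * (\<alpha> * y powr p - \<beta> * z powr p)"
  define m where "m = max y z"
  define S where "S = ((\<alpha> - \<beta>) * m) powr p"
  note pp = powr_minus_one_mult
  have E: "S / 2 - C * R \<le> E"
  proof (cases "z \<le> y")
    case True
    then have "S = (\<alpha> - \<beta>) powr (p - 1) * ((\<alpha> - \<beta>) * y powr p)"
      using ab z by (simp add: S_def m_def max_def powr_mult pp flip: mult.assoc)
    also have "\<dots> \<le> E"
    proof -
      have "\<beta> * z powr p \<le> \<beta> * y powr p"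
        using True z ab p by (intro mult_left_mono powr_mono2) auto
      then show ?thesis
        unfolding E_def by (intro mult_left_mono) (auto simp: algebra_simps)
    qed
    finally show ?thesis using C R0 mult_nonneg_nonneg[OF C R0] powr_ge_zero[of "(\<alpha> - \<beta>) * m" p]
      unfolding S_def by linarith
  next
    case False
    then have m: "m = z" and yz: "\<bar>y - z\<bar> = z - y" by (auto simp: m_def)
    \<comment> \<open>The cutoff is larger where the truncation is smaller, so the weights work
      against the energy: \<open>E\<close> is \<open>S\<close> minus a cross term. The tangent
      inequality makes the cross term linear in \<open>z - y\<close>, and Young's inequality absorbs
      it at the cost of half of \<open>S\<close>.\<close>
    have "(\<alpha> - \<beta>) powr (p - 1) * (\<alpha> * (z powr p - y powr p))
        \<le> (\<alpha> - \<beta>) powr (p - 1) * (\<alpha> * (p * (z powr (p - 1) * (z - y))))"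
      using z ab p by (intro mult_left_mono powr_diff_le) auto
    also have "\<dots> = p * (((\<alpha> - \<beta>) * z) powr (p - 1) * (\<alpha> * (z - y)))"
      using z ab by (simp add: powr_mult mult_ac)
    also have "\<dots> \<le> S / 2 + C * R"
      unfolding S_def m C_def R yz using z ab False p by (intro powr_Young_half) auto
    finally have "(\<alpha> - \<beta>) powr (p - 1) * (\<alpha> * (z powr p - y powr p)) \<le> S / 2 + C * R" .
    moreover have "E = S - (\<alpha> - \<beta>) powr (p - 1) * (\<alpha> * (z powr p - y powr p))"
    proof -
      have "S = (\<alpha> - \<beta>) powr (p - 1) * ((\<alpha> - \<beta>) * z powr p)"
        using ab z by (simp add: S_def m powr_mult pp flip: mult.assoc)
      then show ?thesis by (simp add: E_def algebra_simps)
    qed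
    ultimately show ?thesis by linarith
  qed
  have "\<bar>y * \<alpha> - z * \<beta>\<bar> \<le> (\<alpha> - \<beta>) * m + \<alpha> * \<bar>y - z\<bar>"
  proof -
    \<comment> \<open>Pivoting at \<open>z\<close> puts the larger truncation
      \<open>\<alpha>\<close> in front of the cutoff difference, which is the maximum that
      \<open>R\<close> allows.\<close>
    have "y * \<alpha> - z * \<beta> = (\<alpha> - \<beta>) * z + \<alpha> * (y - z)" by (simp add: algebra_simps)
    moreover have "\<bar>(\<alpha> - \<beta>) * z\<bar> \<le> (\<alpha> - \<beta>) * m"
      using ab z by (auto simp: m_def abs_mult intro!: mult_left_mono)
    moreover have "\<bar>\<alpha> * (y - z)\<bar> = \<alpha> * \<bar>y - z\<bar>" using ab by (simp add: abs_mult)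
    ultimately show ?thesis by linarith
  qed
  then have "\<bar>y * \<alpha> - z * \<beta>\<bar> powr p \<le> 2 powr p * (S + R)"
    unfolding S_def R using ab z p by (intro powr_abs_le_add) (auto simp: m_def)
  \<comment> \<open>This factor 2 pays for the half of \<open>S\<close> spent on absorption; with
    \<open>2 powr p\<close> it gives \<open>2 powr (p + 1)\<close>.\<close>
  also have "S + R \<le> 2 * (E + (1 / 2 + C) * R)" using E by (simp add: algebra_simps)
  \<comment> \<open>If \<open>\<beta> = 0\<close>, then \<open>b \<le> M\<close>, so
    \<open>\<alpha> - \<beta> \<le> a - b\<close>, and the weighted difference is nonnegative.
    Otherwise both values exceed \<open>M\<close> and truncation preserves their difference.\<close>
  also have "E \<le> Hp p (a - b) * (\<alpha> * y powr p - \<beta> * z powr p)"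
  proof (cases "\<beta> = 0")
    case True
    then show ?thesis
      unfolding E_def using ba p z ab
      by (subst Hp_nonneg_eq) (auto intro!: mult_right_mono powr_mono2 simp: \<alpha>_def \<beta>_def)
  next
    case False
    then have "\<alpha> - \<beta> = a - b" using ba by (auto simp: \<alpha>_def \<beta>_def max_def split: if_splits)
    then show ?thesis unfolding E_def using ba by (simp add: Hp_nonneg_eq)
  qed
  finally show ?thesis
    by (simp add: R_def C_def ab powr_add algebra_simps)
qed

text \<open>Exchanging the two points flips the sign of \<open>Hp\<close> and of the weighted
  difference, so their product is symmetric, as are the other terms.\<close>

lemma caccioppoli_pointwise:
  fixes a b M y z p :: real
  assumes p: "1 < p" and z: "0 \<le> y" "0 \<le> z"
  shows "\<bar>y * max (a - M) 0 - z * max (b - M) 0\<bar> powr p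
    \<le> 2 powr (p + 1) * (Hp p (a - b) * (max (a - M) 0 * y powr p - max (b - M) 0 * z powr p)
        + (1 / 2 + (2 * (p - 1)) powr (p - 1))
          * (max (max (a - M) 0) (max (b - M) 0) powr p * \<bar>y - z\<bar> powr p))"
proof (cases "b \<le> a")
  case True
  then show ?thesis using assms by (intro caccioppoli_pointwise_ordered)
next
  case False
  then have "a \<le> b" by simp
  from caccioppoli_pointwise_ordered[OF p this z(2,1), of M] show ?thesis
    using Hp_minus[of p "b - a"] by (simp add: abs_minus_commute max.commute algebra_simps)
qed

text \<open>Used with the second point outside the ball, where the test function vanishes and only
  the first weight survives. The left side can be positive only for \<open>M < a < b\<close>, and
  then \<open>b - a\<close> lies below \<open>b - M\<close>.\<close>

lemma tail_pointwise:
  fixes a b M y p :: real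
  assumes p: "1 < p"
  shows "- (Hp p (a - b) * (max (a - M) 0 * y powr p))
    \<le> max (b - M) 0 powr (p - 1) * (max (a - M) 0 * y powr p)"
proof (cases "M < a")
  case True
  have "- Hp p (a - b) \<le> max (b - M) 0 powr (p - 1)"
  proof (cases "b \<le> a")
    case True then show ?thesis by (auto simp: Hp_nonneg_eq intro: order_trans[of _ 0])
  next
    case False
    then have "- Hp p (a - b) = (b - a) powr (p - 1)"
      using Hp_minus[of p "b - a"] by (simp add: Hp_nonneg_eq)
    also have "\<dots> \<le> max (b - M) 0 powr (p - 1)"
      using \<open>M < a\<close> False p by (intro powr_mono2) auto
    finally show ?thesis .
  qed
  then have "- Hp p (a - b) * (max (a - M) 0 * y powr p)
    \<le> max (b - M) 0 powr (p - 1) * (max (a - M) 0 * y powr p)"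
    by (intro mult_right_mono) auto
  then show ?thesis by simp
qed auto

text \<open>Makes the p-th power of a bounded Lipschitz cutoff Lipschitz; the tangent slope is
  largest at the upper bound \<open>c\<close>.\<close>

lemma abs_powr_diff_le:
  fixes a b c p :: real
  assumes "1 < p" "0 \<le> a" "a \<le> c" "0 \<le> b" "b \<le> c"
  shows "\<bar>a powr p - b powr p\<bar> \<le> p * c powr (p - 1) * \<bar>a - b\<bar>"
proof -
  have *: "x powr p - y powr p \<le> p * c powr (p - 1) * (x - y)"
    if "0 \<le> y" "y \<le> x" "x \<le> c" for x y
  proof -
    have "x powr p - y powr p \<le> p * (x powr (p - 1) * (x - y))"
      using that assms by (intro powr_diff_le) auto
    also have "\<dots> \<le> p * (c powr (p - 1) * (x - y))"
      using that assms by (intro mult_left_mono mult_right_mono powr_mono2) auto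
    finally show ?thesis by simp
  qed
  show ?thesis
  proof (cases "b \<le> a")
    case True
    then have "b powr p \<le> a powr p" using assms by (intro powr_mono2) auto
    then show ?thesis using *[of b a] True assms by simp
  next
    case False
    then have "a powr p \<le> b powr p" using assms by (intro powr_mono2) auto
    then show ?thesis using *[of a b] False assms by simp
  qed
qed

lemma potential_term_le:
  fixes U V M y p :: real
  assumes "1 < p" "0 < M" "0 \<le> y" "0 \<le> V"
  shows "(max (U - M) 0 * y) powr p * V \<le> V * (\<bar>U\<bar> powr (p - 2) * U) * (max (U - M) 0 * y powr p)"
proof (cases "M < U")
  case True
  have "(max (U - M) 0 * y) powr p * V = (U - M) powr (p - 1) * (V * ((U - M) * y powr p))"
    using True assms powr_minus_one_mult[of "U - M" p] by (simp add: powr_mult mult_ac)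
  also have "\<dots> \<le> U powr (p - 1) * (V * ((U - M) * y powr p))"
    using True assms by (intro mult_right_mono powr_mono2) auto
  also have "U powr (p - 1) = \<bar>U\<bar> powr (p - 2) * U"
    using Hp_nonneg_eq[of U p] True assms by (simp add: Hp_def)
  finally show ?thesis using True by (simp add: mult_ac)
qed simp

subsection \<open>Lebesgue measurability and Tonelli on the product space\<close>

lemma AE_lebesgue_vimage:
  fixes T :: "'a::euclidean_space \<Rightarrow> 'b::euclidean_space"
  assumes null: "\<And>N. N \<in> null_sets lborel \<Longrightarrow> T -` N \<in> null_sets lborel"
    and P: "AE x in lebesgue. P x"
  shows "AE z in lebesgue. P (T z)"
proof -
  from P obtain N where N: "N \<in> null_sets lborel" "{x. \<not> P x} \<subseteq> N"
    unfolding AE_completion_iff by (auto simp: eventually_ae_filter)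
  have "T -` N \<in> null_sets lebesgue"
    using null[OF N(1)] by (rule null_sets_completionI)
  then show ?thesis
    by (rule AE_I') (use N in auto)
qed

text \<open>A Borel map may pull a Lebesgue measurable set back to a nonmeasurable one; null
  preimages of null sets exclude this. The maps in question are the projections, the difference and
  the swap on the product space.\<close>

lemma lebesgue_measurable_vimage:
  fixes T :: "'a::euclidean_space \<Rightarrow> 'b::euclidean_space"
  assumes T: "T \<in> borel_measurable borel"
    and null: "\<And>N. N \<in> null_sets lborel \<Longrightarrow> T -` N \<in> null_sets lborel"
  shows "T \<in> lebesgue \<rightarrow>\<^sub>M lebesgue"
proof (rule completion.measurable_completion2)
  show T': "T \<in> lebesgue \<rightarrow>\<^sub>M lborel"
    using T by (simp add: measurable_completion)
  show "null_sets lborel \<subseteq> null_sets (distr lebesgue lborel T)"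
  proof
    fix N :: "'b set" assume N: "N \<in> null_sets lborel"
    then have "T -` N \<in> null_sets lebesgue" by (intro null_sets_completionI null)
    then show "N \<in> null_sets (distr lebesgue lborel T)"
      using N T' by (subst null_sets_distr_iff) auto
  qed
qed

lemma distr_lborel_diff: "distr lborel borel (\<lambda>y. x - y) = lborel" for x :: "'a::euclidean_space"
  by (subst (2) lborel_affine[of "-1" x]) (simp_all add: density_1)

lemma null_sets_lborel_vimage_diff:
  fixes x :: "'a::euclidean_space"
  assumes "N \<in> null_sets lborel"
  shows "(\<lambda>y. x - y) -` N \<in> null_sets lborel"
proof -
  have "N \<in> null_sets (distr lborel borel (\<lambda>y. x - y))"
    using assms by (simp add: distr_lborel_diff)
  then show ?thesis by (subst (asm) null_sets_distr_iff) auto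
qed

lemma null_sets_lborel_vimage_fst:
  fixes N :: "'a::euclidean_space set"
  assumes "N \<in> null_sets lborel"
  shows "(fst :: 'a \<times> 'b::euclidean_space \<Rightarrow> 'a) -` N \<in> null_sets lborel"
proof -
  have "(fst :: 'a \<times> 'b \<Rightarrow> 'a) -` N = N \<times> UNIV" by auto
  moreover have "N \<times> UNIV \<in> null_sets (lborel \<Otimes>\<^sub>M (lborel :: 'b measure))"
    using assms by (intro lborel.times_in_null_sets1) auto
  ultimately show ?thesis by (simp add: lborel_prod)
qed

lemma null_sets_lborel_vimage_snd:
  fixes N :: "'b::euclidean_space set"
  assumes "N \<in> null_sets lborel"
  shows "(snd :: 'a::euclidean_space \<times> 'b \<Rightarrow> 'b) -` N \<in> null_sets lborel"
proof -
  have "(snd :: 'a \<times> 'b \<Rightarrow> 'b) -` N = UNIV \<times> N" by auto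
  moreover have "UNIV \<times> N \<in> null_sets ((lborel :: 'a measure) \<Otimes>\<^sub>M lborel)"
    using assms by (intro lborel.times_in_null_sets2) auto
  ultimately show ?thesis by (simp add: lborel_prod)
qed

text \<open>For a fixed first coordinate the slice is a reflected translate of \<open>N\<close>,
  hence null, and Tonelli's theorem sums up the slices.\<close>

lemma null_sets_lborel_vimage_fst_diff_snd:
  fixes N :: "'a::euclidean_space set"
  assumes "N \<in> null_sets lborel"
  shows "(\<lambda>z. fst z - snd z) -` N \<in> null_sets lborel"
proof -
  have [measurable]: "N \<in> sets borel" using assms by auto
  have meas: "(\<lambda>z. fst z - snd z) -` N \<in> sets (borel :: ('a \<times> 'a) measure)"
  proof -
    have "(\<lambda>z :: 'a \<times> 'a. fst z - snd z) \<in> borel_measurable borel"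
      by (intro borel_measurable_continuous_onI continuous_intros)
    then show ?thesis
      by (auto dest!: measurable_sets[of _ _ _ N])
  qed
  have "emeasure (lborel \<Otimes>\<^sub>M lborel) ((\<lambda>z. fst z - snd z) -` N)
      = (\<integral>\<^sup>+x. emeasure lborel (Pair x -` ((\<lambda>z. fst z - snd z) -` N)) \<partial>lborel)"
    by (rule lborel.emeasure_pair_measure_alt) (simp only: lborel_prod sets_lborel meas)
  also have "\<dots> = (\<integral>\<^sup>+(x::'a). 0 \<partial>lborel)"
  proof (rule nn_integral_cong)
    fix x :: 'a
    have "Pair x -` ((\<lambda>z. fst z - snd z) -` N) = (\<lambda>y. x - y) -` N" by auto
    then show "emeasure lborel (Pair x -` ((\<lambda>z. fst z - snd z) -` N)) = 0"
      using null_sets_lborel_vimage_diff[OF assms, of x] by auto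
  qed
  finally show ?thesis using meas by (simp add: lborel_prod null_sets_def)
qed

lemma lebesgue_measurable_fst [measurable]:
  "(fst :: 'a::euclidean_space \<times> 'b::euclidean_space \<Rightarrow> 'a) \<in> lebesgue \<rightarrow>\<^sub>M lebesgue"
  by (intro lebesgue_measurable_vimage null_sets_lborel_vimage_fst
      borel_measurable_continuous_onI continuous_on_fst[OF continuous_on_id])

lemma lebesgue_measurable_snd [measurable]:
  "(snd :: 'a::euclidean_space \<times> 'b::euclidean_space \<Rightarrow> 'b) \<in> lebesgue \<rightarrow>\<^sub>M lebesgue"
  by (intro lebesgue_measurable_vimage null_sets_lborel_vimage_snd
      borel_measurable_continuous_onI continuous_on_snd[OF continuous_on_id])

lemma lebesgue_measurable_fst_diff_snd [measurable]:
  "(\<lambda>z :: 'a::euclidean_space \<times> 'a. fst z - snd z) \<in> lebesgue \<rightarrow>\<^sub>M lebesgue"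
  by (intro lebesgue_measurable_vimage null_sets_lborel_vimage_fst_diff_snd
      borel_measurable_continuous_onI continuous_intros)

section \<open>Swap and Tonelli for the completed product\<close>

lemma distr_lborel_swap:
  "distr lborel lborel (\<lambda>z :: 'b::euclidean_space \<times> 'a::euclidean_space. (snd z, fst z)) = lborel"
  using lborel_pair.distr_pair_swap[where ?'a = 'a and ?'b = 'b] by (simp add: lborel_prod case_prod_beta')

lemma borel_measurable_swap:
  "(\<lambda>z :: 'b::euclidean_space \<times> 'a::euclidean_space. (snd z, fst z)) \<in> borel_measurable borel"
  by (intro borel_measurable_continuous_onI continuous_intros)

lemma null_sets_lborel_vimage_swap:
  fixes N :: "('a::euclidean_space \<times> 'b::euclidean_space) set"
  assumes "N \<in> null_sets lborel"
  shows "(\<lambda>z. (snd z, fst z)) -` N \<in> null_sets lborel"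
proof -
  have "N \<in> null_sets (distr lborel lborel (\<lambda>z. (snd z, fst z)))"
    using assms by (simp only: distr_lborel_swap)
  then show ?thesis
    by (subst (asm) null_sets_distr_iff) (use borel_measurable_swap in auto)
qed

lemma lebesgue_measurable_swap:
  "(\<lambda>z :: 'b::euclidean_space \<times> 'a::euclidean_space. (snd z, fst z)) \<in> lebesgue \<rightarrow>\<^sub>M lebesgue"
  by (intro lebesgue_measurable_vimage null_sets_lborel_vimage_swap borel_measurable_swap)

lemma nn_integral_lebesgue_swap:
  fixes h :: "'a::euclidean_space \<times> 'b::euclidean_space \<Rightarrow> ennreal"
  assumes "h \<in> borel_measurable lebesgue"
  shows "(\<integral>\<^sup>+z. h (snd z, fst z) \<partial>lebesgue) = (\<integral>\<^sup>+z. h z \<partial>lebesgue)"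
proof -
  obtain h' where [measurable]: "h' \<in> borel_measurable lborel" and h': "AE z in lborel. h z = h' z"
    using completion_ex_borel_measurable[OF assms] by auto
  have "(\<integral>\<^sup>+z. h (snd z, fst z) \<partial>lebesgue) = (\<integral>\<^sup>+z. h' (snd z, fst z) \<partial>lebesgue)"
    by (intro nn_integral_cong_AE AE_lebesgue_vimage[OF null_sets_lborel_vimage_swap] AE_completion h')
  also have "\<dots> = (\<integral>\<^sup>+z. h' z \<partial>distr lborel lborel (\<lambda>z. (snd z, fst z)))"
    unfolding nn_integral_completion
    by (subst nn_integral_distr) (use borel_measurable_swap in auto)
  also have "\<dots> = (\<integral>\<^sup>+z. h z \<partial>lebesgue)"
    unfolding distr_lborel_swap nn_integral_completion by (intro nn_integral_cong_AE) (use h' in auto)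
  finally show ?thesis .
qed

text \<open>\<open>lebesgue\<close> on the product space is the completion of a product, not the
  product of completions, so Tonelli is applied to Borel representatives. The inner integral is the
  same for every \<open>x\<close>, because y -> x - y preserves null sets.\<close>

lemma nn_integral_lebesgue_convolution:
  fixes f g k :: "'a::euclidean_space \<Rightarrow> ennreal"
  assumes "f \<in> borel_measurable lebesgue" "g \<in> borel_measurable lebesgue"
    and "k \<in> borel_measurable lebesgue"
  shows "(\<integral>\<^sup>+z. f (fst z) * g (snd z) * k (fst z - snd z) \<partial>lebesgue)
    = (\<integral>\<^sup>+x. f x * (\<integral>\<^sup>+y. g y * k (x - y) \<partial>lebesgue) \<partial>lebesgue)"
proof -
  obtain f' where [measurable]: "f' \<in> borel_measurable lborel" and f': "AE z in lborel. f z = f' z"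
    using completion_ex_borel_measurable[OF assms(1)] by auto
  obtain g' where [measurable]: "g' \<in> borel_measurable lborel" and g': "AE z in lborel. g z = g' z"
    using completion_ex_borel_measurable[OF assms(2)] by auto
  obtain k' where [measurable]: "k' \<in> borel_measurable lborel" and k': "AE z in lborel. k z = k' z"
    using completion_ex_borel_measurable[OF assms(3)] by auto
  have inner: "(\<integral>\<^sup>+y. g y * k (x - y) \<partial>lebesgue) = (\<integral>\<^sup>+y. g' y * k' (x - y) \<partial>lborel)" for x
  proof -
    have k: "AE y in lebesgue. k (x - y) = k' (x - y)"
      by (intro AE_lebesgue_vimage[OF null_sets_lborel_vimage_diff] AE_completion k')
    have "(\<integral>\<^sup>+y. g y * k (x - y) \<partial>lebesgue) = (\<integral>\<^sup>+y. g' y * k' (x - y) \<partial>lebesgue)"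
      by (intro nn_integral_cong_AE) (use k AE_completion[OF g'] in \<open>eventually_elim, simp\<close>)
    then show ?thesis by (simp add: nn_integral_completion)
  qed
  have ae: "AE z in lebesgue. f (fst z) = f' (fst z)" "AE z in lebesgue. g (snd z) = g' (snd z)"
    "AE z in lebesgue. k (fst z - snd z) = k' (fst z - snd z)"
    using AE_lebesgue_vimage[OF null_sets_lborel_vimage_fst AE_completion[OF f']]
      AE_lebesgue_vimage[OF null_sets_lborel_vimage_snd AE_completion[OF g']]
      AE_lebesgue_vimage[OF null_sets_lborel_vimage_fst_diff_snd AE_completion[OF k']]
    by auto
  have "(\<integral>\<^sup>+z. f (fst z) * g (snd z) * k (fst z - snd z) \<partial>lebesgue)
      = (\<integral>\<^sup>+z. f' (fst z) * g' (snd z) * k' (fst z - snd z) \<partial>lebesgue)"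
    by (intro nn_integral_cong_AE) (use ae in \<open>eventually_elim, simp\<close>)
  also have "\<dots> = (\<integral>\<^sup>+z. f' (fst z) * g' (snd z) * k' (fst z - snd z) \<partial>(lborel \<Otimes>\<^sub>M lborel))"
    by (simp add: nn_integral_completion lborel_prod)
  also have "\<dots> = (\<integral>\<^sup>+x. \<integral>\<^sup>+y. f' x * g' y * k' (x - y) \<partial>lborel \<partial>lborel)"
    by (subst lborel.nn_integral_fst[symmetric]) auto
  also have "\<dots> = (\<integral>\<^sup>+x. f' x * (\<integral>\<^sup>+y. g y * k (x - y) \<partial>lebesgue) \<partial>lborel)"
    unfolding inner by (intro nn_integral_cong, subst nn_integral_cmult[symmetric]) (auto simp: mult.assoc)
  also have "\<dots> = (\<integral>\<^sup>+x. f x * (\<integral>\<^sup>+y. g y * k (x - y) \<partial>lebesgue) \<partial>lborel)"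
    by (intro nn_integral_cong_AE) (use f' in \<open>eventually_elim, simp\<close>)
  finally show ?thesis by (simp add: nn_integral_completion)
qed

subsection \<open>Integrability of the kernel\<close>

text \<open>Comparison with a step function: where positive, \<open>f\<close> lies below some height
  \<open>A k\<close> on a ball of radius \<open>\<rho> k\<close>, whose volume is a multiple of
  \<open>\<rho> k ^ DIM('a)\<close>. Dyadic radii then treat a singularity at the origin and decay
  at infinity alike.\<close>

lemma nn_integral_lborel_finite_of_balls:
  fixes f :: "'a::euclidean_space \<Rightarrow> real" and A \<rho> :: "nat \<Rightarrow> real"
  assumes A: "\<And>k. 0 \<le> A k" and \<rho>: "\<And>k. 0 \<le> \<rho> k"
    and summ: "summable (\<lambda>k. A k * \<rho> k ^ DIM('a))"
    and f: "\<And>h. 0 < f h \<Longrightarrow> \<exists>k. norm h < \<rho> k \<and> f h \<le> A k"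
  shows "(\<integral>\<^sup>+h. ennreal (f h) \<partial>lborel) < \<infinity>"
proof -
  have "(\<integral>\<^sup>+h. ennreal (f h) \<partial>lborel)
      \<le> (\<integral>\<^sup>+h. (\<Sum>k. ennreal (A k) * indicator (ball 0 (\<rho> k)) h) \<partial>(lborel :: 'a measure))"
  proof (rule nn_integral_mono)
    fix h :: 'a
    show "ennreal (f h) \<le> (\<Sum>k. ennreal (A k) * indicator (ball 0 (\<rho> k)) h)"
    proof (cases "0 < f h")
      case True
      then obtain k where k: "norm h < \<rho> k" "f h \<le> A k" using f by blast
      then have "ennreal (f h) \<le> ennreal (A k) * indicator (ball 0 (\<rho> k)) h"
        by (auto intro: ennreal_leI)
      also have "\<dots> \<le> (\<Sum>k. ennreal (A k) * indicator (ball 0 (\<rho> k)) h)"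
      proof -
        define F where "F i = ennreal (A i) * indicator (ball 0 (\<rho> i)) h" for i
        have "F k \<le> (\<Sum>i. F i)" using sum_le_suminf[of F "{k}"] by simp
        then show ?thesis by (simp add: F_def)
      qed
      finally show ?thesis .
    qed (simp add: ennreal_neg)
  qed
  also have "\<dots> = (\<Sum>k. \<integral>\<^sup>+h. ennreal (A k) * indicator (ball 0 (\<rho> k)) h \<partial>(lborel :: 'a measure))"
    by (intro nn_integral_suminf borel_measurable_times_ennreal borel_measurable_indicator) auto
  also have "\<dots> = (\<Sum>k. ennreal (unit_ball_vol (DIM('a)) * (A k * \<rho> k ^ DIM('a))))"
    using A \<rho> by (simp add: nn_integral_cmult_indicator emeasure_ball mult_ac flip: ennreal_mult')
  also have "\<dots> < \<infinity>"
    using A \<rho> summable_mult[OF summ, of "unit_ball_vol (DIM('a))"]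
    by (subst suminf_ennreal2) (auto intro!: mult_nonneg_nonneg)
  finally show ?thesis .
qed

lemma power_powr_commute: "0 \<le> x \<Longrightarrow> (x ^ k) powr a = (x powr a) ^ k" for x a :: real
  by (induction k) (auto simp: powr_mult)

text \<open>On the shell 2^-(k+1) \<le> |h| < 2^-k the integrand is at most 2^((k+1)a). Multiplied
  by the volume of the ball this is a geometric series of ratio 2^(a-n), which is below 1 since a <
  n.\<close>

lemma nn_integral_norm_powr_inner:
  fixes a :: real
  assumes "0 \<le> a" "a < DIM('a::euclidean_space)"
  shows "(\<integral>\<^sup>+h. ennreal (indicator (ball 0 1) h / norm h powr a) \<partial>(lborel :: 'a measure)) < \<infinity>"
proof (rule nn_integral_lborel_finite_of_balls)
  define c :: real where "c = 2 powr a / 2 ^ DIM('a)"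
  have "c < 1"
    using assms(2) powr_less_cancel_iff[of 2 a "DIM('a)"] by (simp add: c_def powr_realpow)
  moreover have "0 \<le> c" by (simp add: c_def)
  moreover have eq: "(2 ^ Suc k) powr a * ((1 / 2) ^ k) ^ DIM('a) = 2 powr a * c ^ k" for k :: nat
  proof -
    have "(2 ^ Suc k :: real) powr a = 2 powr a * (2 powr a) ^ k"
      by (subst power_powr_commute) auto
    moreover have "((1 / 2 :: real) ^ k) ^ DIM('a) = (1 / 2 ^ DIM('a)) ^ k"
      by (simp add: power_divide mult.commute[of k] flip: power_mult)
    ultimately show ?thesis by (simp add: c_def power_divide)
  qed
  ultimately have "summable (\<lambda>k. 2 powr a * c ^ k)"
    by (intro summable_mult summable_geometric) auto
  then show "summable (\<lambda>k. (2 ^ Suc k) powr a * ((1 / 2 :: real) ^ k) ^ DIM('a))"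
    by (simp only: eq)
next
  fix h :: 'a
  assume "0 < indicator (ball 0 1) h / norm h powr a"
  \<comment> \<open>A positive value excludes the origin, where the denominator is 0 and the
    quotient is 0 by convention.\<close>
  then have h: "0 < norm h" "norm h < 1"
    by (cases "norm h < 1"; cases "h = 0"; simp)+
  define k where "k = (LEAST k. (1 / 2) ^ Suc k \<le> norm h)"
  obtain m where "(1 / 2) ^ m < norm h"
    using real_arch_pow_inv[OF h(1), of "1 / 2"] by auto
  moreover have "(1 / 2 :: real) ^ Suc m \<le> (1 / 2) ^ m" by simp
  ultimately have "(1 / 2) ^ Suc m \<le> norm h" by linarith
  then have k: "(1 / 2) ^ Suc k \<le> norm h" unfolding k_def by (rule LeastI)
  \<comment> \<open>For \<open>k = 0\<close> this is the restriction to the unit ball, for larger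
    \<open>k\<close> the minimality of the shell index.\<close>
  have less: "norm h < (1 / 2) ^ k"
  proof (cases k)
    case (Suc j)
    have "\<not> (1 / 2) ^ Suc j \<le> norm h"
      by (rule not_less_Least) (simp only: Suc[unfolded k_def] lessI)
    then show ?thesis unfolding Suc by linarith
  qed (use h in simp)
  have "1 / norm h \<le> 2 ^ Suc k" using k h by (simp add: field_simps power_divide)
  then have "(1 / norm h) powr a \<le> (2 ^ Suc k) powr a"
    using assms(1) by (intro powr_mono2) auto
  then have "indicator (ball 0 1) h / norm h powr a \<le> (2 ^ Suc k) powr a"
    using h by (simp add: powr_divide)
  with less show "\<exists>k. norm h < (1 / 2) ^ k \<and> indicator (ball 0 1) h / norm h powr a \<le> (2 ^ Suc k) powr a"
    by blast
qed auto

text \<open>The same series read outwards: height 2^(-ka) on the shell 2^k \<le> |h| < 2^(k+1),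
  hence ratio 2^(n-a), below 1 since a > n.\<close>

lemma nn_integral_norm_powr_outer:
  fixes a :: real
  assumes "DIM('a::euclidean_space) < a"
  shows "(\<integral>\<^sup>+h. ennreal (indicator (- ball 0 1) h / norm h powr a) \<partial>(lborel :: 'a measure)) < \<infinity>"
proof (rule nn_integral_lborel_finite_of_balls)
  define c :: real where "c = 2 ^ DIM('a) / 2 powr a"
  have "c < 1"
    using assms powr_less_cancel_iff[of 2 "DIM('a)" a] by (simp add: c_def powr_realpow)
  moreover have "0 \<le> c" by (simp add: c_def)
  moreover have eq: "((1 / 2) ^ k) powr a * (2 ^ Suc k) ^ DIM('a) = 2 ^ DIM('a) * c ^ k" for k :: nat
  proof -
    have "((1 / 2 :: real) ^ k) powr a = (1 / 2 powr a) ^ k"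
      by (subst power_powr_commute) (auto simp: powr_divide)
    moreover have "(2 ^ Suc k :: real) ^ DIM('a) = 2 ^ DIM('a) * (2 ^ DIM('a)) ^ k"
      by (simp add: power_mult_distrib mult.commute[of k] flip: power_mult)
    ultimately show ?thesis by (simp add: c_def power_divide)
  qed
  ultimately have "summable (\<lambda>k. 2 ^ DIM('a) * c ^ k)"
    by (intro summable_mult summable_geometric) auto
  then show "summable (\<lambda>k. ((1 / 2) ^ k) powr a * (2 ^ Suc k :: real) ^ DIM('a))"
    by (simp only: eq)
next
  fix h :: 'a
  assume "0 < indicator (- ball 0 1) h / norm h powr a"
  then have h: "1 \<le> norm h"
    by (cases "norm h < 1") auto
  define k where "k = (LEAST k. norm h < 2 ^ Suc k)"
  obtain m where "norm h < 2 ^ m"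
    using real_arch_pow[of 2 "norm h"] by auto
  moreover have "(2 :: real) ^ m \<le> 2 ^ Suc m" by simp
  ultimately have "norm h < 2 ^ Suc m" by linarith
  then have k: "norm h < 2 ^ Suc k" unfolding k_def by (rule LeastI)
  have ge: "2 ^ k \<le> norm h"
  proof (cases k)
    case (Suc j)
    have "\<not> norm h < 2 ^ Suc j"
      by (rule not_less_Least) (simp only: Suc[unfolded k_def] lessI)
    then show ?thesis unfolding Suc by linarith
  qed (use h in simp)
  have "1 / norm h \<le> (1 / 2) ^ k"
    using frac_le[of 1 1 "2 ^ k" "norm h"] ge by (simp add: power_divide)
  then have "(1 / norm h) powr a \<le> ((1 / 2) ^ k) powr a"
    using assms by (intro powr_mono2) auto
  then have "indicator (- ball 0 1) h / norm h powr a \<le> ((1 / 2) ^ k) powr a"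
    using h by (simp add: powr_divide)
  with k show "\<exists>k. norm h < 2 ^ Suc k \<and> indicator (- ball 0 1) h / norm h powr a \<le> ((1 / 2) ^ k) powr a"
    by blast
qed auto

text \<open>Differences of a bounded Lipschitz cutoff produce this kernel. Near the origin the
  Lipschitz bound leaves |h|^(p-N) with N - p < n, as \<sigma> < p; far away the bound by
  \<open>C\<close> leaves |h|^(-N) with N > n. In the application \<sigma> = ps.\<close>

lemma nn_integral_min_powr_kernel:
  fixes \<sigma> p :: real
  assumes \<sigma>: "0 < \<sigma>" "\<sigma> < p" and "0 \<le> \<Lambda>" "0 \<le> C"
  shows "(\<integral>\<^sup>+h. ennreal (min (\<Lambda> * norm h) C powr p / norm h powr (DIM('a) + \<sigma>))
    \<partial>(lborel :: 'a::euclidean_space measure)) < \<infinity>"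
proof -
  define N where "N = DIM('a) + \<sigma>"
  \<comment> \<open>Raising the exponent to at least 0 only enlarges the bound inside the unit ball,
    and it meets the sign condition of the inner integral.\<close>
  define a where "a = max 0 (N - p)"
  define F where "F h = ennreal (indicator (ball 0 1) h / norm h powr a)" for h :: 'a
  define G where "G h = ennreal (indicator (- ball 0 1) h / norm h powr N)" for h :: 'a
  have [measurable]: "ball (0 :: 'a) 1 \<in> sets borel" by simp
  have [measurable]: "F \<in> borel_measurable borel" "G \<in> borel_measurable borel"
    unfolding F_def[abs_def] G_def[abs_def] by measurable
  have F: "(\<integral>\<^sup>+h. F h \<partial>lborel) < \<infinity>"
    unfolding F_def by (rule nn_integral_norm_powr_inner) (use \<sigma> in \<open>simp_all add: a_def N_def\<close>)
  have G: "(\<integral>\<^sup>+h. G h \<partial>lborel) < \<infinity>"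
    unfolding G_def by (rule nn_integral_norm_powr_outer) (use \<sigma> in \<open>simp add: N_def\<close>)
  have "(\<integral>\<^sup>+h. ennreal (min (\<Lambda> * norm h) C powr p / norm h powr N) \<partial>(lborel :: 'a measure))
    \<le> (\<integral>\<^sup>+h. ennreal (\<Lambda> powr p) * F h + ennreal (C powr p) * G h \<partial>lborel)"
  proof (rule nn_integral_mono)
    fix h :: 'a
    consider "h = 0" | "h \<noteq> 0" "norm h < 1" | "1 \<le> norm h" by fastforce
    then show "ennreal (min (\<Lambda> * norm h) C powr p / norm h powr N)
      \<le> ennreal (\<Lambda> powr p) * F h + ennreal (C powr p) * G h"
    proof cases
      case 1
      then show ?thesis by simp
    next
      case 2
      have "min (\<Lambda> * norm h) C powr p / norm h powr N \<le> (\<Lambda> * norm h) powr p / norm h powr N"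
        using assms by (intro divide_right_mono powr_mono2) auto
      also have "\<dots> = \<Lambda> powr p * norm h powr (p - N)"
        using assms(3) by (simp add: powr_mult powr_diff[of "norm h" p N])
      also have "\<dots> \<le> \<Lambda> powr p * norm h powr (- a)"
        using 2 by (intro mult_left_mono powr_mono') (auto simp: a_def)
      also have "\<dots> = \<Lambda> powr p * (1 / norm h powr a)"
        by (simp add: powr_minus divide_inverse)
      finally have "ennreal (min (\<Lambda> * norm h) C powr p / norm h powr N) \<le> ennreal (\<Lambda> powr p) * F h"
        using 2 by (simp add: F_def ennreal_leI flip: ennreal_mult')
      then show ?thesis by (rule order_trans) simp
    next
      case 3
      have "min (\<Lambda> * norm h) C powr p / norm h powr N \<le> C powr p / norm h powr N"
        using assms by (intro divide_right_mono powr_mono2) auto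
      then have "ennreal (min (\<Lambda> * norm h) C powr p / norm h powr N) \<le> ennreal (C powr p) * G h"
        using 3 by (simp add: G_def ennreal_leI flip: ennreal_mult')
      then show ?thesis by (rule order_trans) simp
    qed
  qed
  also have "\<dots> = ennreal (\<Lambda> powr p) * (\<integral>\<^sup>+h. F h \<partial>lborel) + ennreal (C powr p) * (\<integral>\<^sup>+h. G h \<partial>lborel)"
    by (simp add: nn_integral_add nn_integral_cmult)
  also have "\<dots> < \<infinity>"
    using F G by (simp add: ennreal_mult_less_top)
  finally show ?thesis by (simp add: N_def)
qed

subsection \<open>The test function\<close>

lemma Cc_infinity_continuous:
  assumes "\<zeta> \<in> Cc_infinity U"
  shows "continuous_on UNIV \<zeta>"
proof -
  have "Ck 0 \<zeta>" using assms unfolding Cc_infinity_def by blast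
  then show ?thesis by simp
qed

lemma Cc_infinity_zero:
  assumes "\<zeta> \<in> Cc_infinity U" "x \<notin> U"
  shows "\<zeta> x = 0"
  using assms closure_subset[of "{x. \<zeta> x \<noteq> 0}"] by (auto simp: Cc_infinity_def supp_def)

section \<open>Bounds for smooth cutoffs\<close>

lemma continuous_compact_supp_bounded:
  fixes f :: "real ^ 'n \<Rightarrow> real"
  assumes "continuous_on UNIV f" "compact S" "\<And>x. x \<notin> S \<Longrightarrow> f x = 0"
  obtains C where "0 \<le> C" "\<And>x. \<bar>f x\<bar> \<le> C"
proof -
  have "compact (f ` S)"
    using assms by (meson compact_continuous_image continuous_on_subset subset_UNIV)
  then obtain C where C: "\<And>x. x \<in> S \<Longrightarrow> \<bar>f x\<bar> \<le> C"
    using compact_imp_bounded[of "f ` S"] by (auto simp: bounded_iff)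
  have "\<bar>f x\<bar> \<le> max C 0" for x using C[of x] assms(3)[of x] by (cases "x \<in> S") auto
  then show thesis by (intro that[of "max C 0"]) auto
qed

lemma Cc_infinity_bounded:
  assumes "\<zeta> \<in> Cc_infinity U"
  obtains C where "0 \<le> C" "\<And>x. \<bar>\<zeta> x\<bar> \<le> C"
proof (rule continuous_compact_supp_bounded)
  show "continuous_on UNIV \<zeta>" by (rule Cc_infinity_continuous) fact
  show "compact (supp \<zeta>)" using assms by (simp add: Cc_infinity_def)
  show "\<zeta> x = 0" if "x \<notin> supp \<zeta>" for x
    using that closure_subset[of "{x. \<zeta> x \<noteq> 0}"] by (auto simp: supp_def)
qed (use that in blast)

text \<open>The partial derivatives are continuous and vanish off the compact support, so they are
  bounded. The sum of their bounds dominates the operator norm of the derivative, and the mean value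
  inequality applies on the whole space.\<close>

lemma Cc_infinity_lipschitz:
  fixes \<zeta> :: "real ^ 'n \<Rightarrow> real"
  assumes \<zeta>: "\<zeta> \<in> Cc_infinity U"
  obtains \<Lambda> where "0 \<le> \<Lambda>" "\<And>x y. \<bar>\<zeta> x - \<zeta> y\<bar> \<le> \<Lambda> * norm (x - y)"
proof -
  define D where "D i x = frechet_derivative \<zeta> (at x) (axis i 1)" for i x
  have "Ck (Suc 0) \<zeta>" using \<zeta> unfolding Cc_infinity_def by blast
  then have diff: "\<zeta> differentiable_on UNIV" and D: "continuous_on UNIV (D i)" for i
    by (auto simp: D_def[abs_def])
  have der: "(\<zeta> has_derivative frechet_derivative \<zeta> (at x)) (at x)" for x
    using diff by (auto simp: differentiable_on_def frechet_derivative_works)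
  have D0: "D i x = 0" if "x \<notin> supp \<zeta>" for i x
  proof -
    have "(\<zeta> has_derivative (\<lambda>_. 0)) (at x)"
    proof (rule has_derivative_transform_within_open)
      show "((\<lambda>_. 0) has_derivative (\<lambda>_. 0)) (at x)" by (rule has_derivative_const)
      show "open (- supp \<zeta>)" by (simp add: supp_def open_Compl)
      show "x \<in> - supp \<zeta>" using that by simp
      show "0 = \<zeta> y" if "y \<in> - supp \<zeta>" for y
        using that closure_subset[of "{x. \<zeta> x \<noteq> 0}"] by (auto simp: supp_def)
    qed
    from frechet_derivative_at[OF this, symmetric] show ?thesis
      by (simp add: D_def)
  qed
  have "\<exists>C. 0 \<le> C \<and> (\<forall>x. \<bar>D i x\<bar> \<le> C)" for i
    by (rule continuous_compact_supp_bounded[of "D i" "supp \<zeta>"])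
       (use D D0 \<zeta> in \<open>auto simp: Cc_infinity_def\<close>)
  then obtain C where C: "\<And>i. 0 \<le> C i" "\<And>i x. \<bar>D i x\<bar> \<le> C i" by metis
  define \<Lambda> where "\<Lambda> = (\<Sum>i\<in>UNIV. C i)"
  have bound: "onorm (frechet_derivative \<zeta> (at x)) \<le> \<Lambda>" for x
  proof (rule onorm_bound)
    show "0 \<le> \<Lambda>" using C by (auto simp: \<Lambda>_def intro: sum_nonneg)
    fix h :: "real ^ 'n"
    interpret f': linear "frechet_derivative \<zeta> (at x)"
      using der[of x] by (rule has_derivative_linear)
    have "h = (\<Sum>i\<in>UNIV. h $ i *\<^sub>R axis i 1)"
      using basis_expansion[of h] by (simp add: scalar_mult_eq_scaleR)
    then have "frechet_derivative \<zeta> (at x) h = frechet_derivative \<zeta> (at x) (\<Sum>i\<in>UNIV. h $ i *\<^sub>R axis i 1)"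
      by simp
    also have "\<dots> = (\<Sum>i\<in>UNIV. h $ i * D i x)"
      by (simp add: f'.sum f'.scaleR D_def)
    finally have "norm (frechet_derivative \<zeta> (at x) h) \<le> (\<Sum>i\<in>UNIV. \<bar>h $ i * D i x\<bar>)"
      by (simp add: sum_abs)
    also have "\<dots> \<le> (\<Sum>i\<in>UNIV. norm h * C i)"
      unfolding abs_mult by (intro sum_mono mult_mono component_le_norm_cart C) auto
    finally show "norm (frechet_derivative \<zeta> (at x) h) \<le> \<Lambda> * norm h"
      by (simp add: \<Lambda>_def sum_distrib_left mult.commute)
  qed
  have "\<bar>\<zeta> x - \<zeta> y\<bar> \<le> \<Lambda> * norm (x - y)" for x y
    using differentiable_bound[of UNIV \<zeta> "\<lambda>x. frechet_derivative \<zeta> (at x)" \<Lambda> x y] der bound by auto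
  moreover have "0 \<le> \<Lambda>" using C by (auto simp: \<Lambda>_def intro: sum_nonneg)
  ultimately show thesis using that by blast
qed

section \<open>Products with cutoffs in the function spaces\<close>

lemma nn_integral_lebesgue_product_kernel:
  fixes f k :: "'a::euclidean_space \<Rightarrow> ennreal"
  assumes f: "f \<in> borel_measurable lebesgue" and k: "k \<in> borel_measurable borel"
  shows "(\<integral>\<^sup>+z. f (fst z) * k (fst z - snd z) \<partial>lebesgue)
    = (\<integral>\<^sup>+x. f x \<partial>lebesgue) * (\<integral>\<^sup>+h. k h \<partial>lborel)"
proof -
  have k': "k \<in> borel_measurable lebesgue" using k by (simp add: measurable_completion)
  have "(\<integral>\<^sup>+y. k (x - y) \<partial>lebesgue) = (\<integral>\<^sup>+h. k h \<partial>lborel)" for x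
  proof -
    have "(\<integral>\<^sup>+y. k (x - y) \<partial>lebesgue) = (\<integral>\<^sup>+h. k h \<partial>distr lborel borel (\<lambda>y. x - y))"
      using k by (subst nn_integral_distr) (auto simp: nn_integral_completion)
    then show ?thesis by (simp add: distr_lborel_diff)
  qed
  then show ?thesis
    using nn_integral_lebesgue_convolution[OF f _ k', of "\<lambda>_. 1"] f
    by (simp add: nn_integral_multc)
qed

text \<open>Here \<open>v\<close> is a contraction of \<open>u\<close>, later its truncation. A
  difference of the product splits into a difference of \<open>v\<close>, controlled by the energy
  of \<open>u\<close> on the same pairs, and a difference of \<open>\<eta>\<close> weighted by
  |u|^p, controlled by integrating the cutoff kernel first.\<close>

lemma mult_cutoff_in_Xsp0:
  fixes u v \<eta> :: "real ^ 'n \<Rightarrow> real"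
  assumes s: "0 < s" "s < 1" and p: "1 < p" and \<Omega>: "\<Omega> \<in> sets lebesgue"
    and u: "u \<in> Xsp s p \<Omega>"
    and v: "v \<in> borel_measurable lebesgue" "\<And>x. \<bar>v x\<bar> \<le> \<bar>u x\<bar>" "\<And>x y. \<bar>v x - v y\<bar> \<le> \<bar>u x - u y\<bar>"
    and \<eta>: "\<eta> \<in> borel_measurable lebesgue" "\<And>x. \<bar>\<eta> x\<bar> \<le> C" "\<And>x y. \<bar>\<eta> x - \<eta> y\<bar> \<le> \<Lambda> * norm (x - y)"
    and \<eta>0: "\<And>x. x \<notin> \<Omega> \<Longrightarrow> \<eta> x = 0"
    and C: "0 \<le> C" and \<Lambda>: "0 \<le> \<Lambda>"
  shows "(\<lambda>x. v x * \<eta> x) \<in> Xsp0 s p \<Omega>"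
proof -
  note [measurable] = v(1) \<eta>(1) \<Omega>
  have um[measurable]: "u \<in> borel_measurable lebesgue"
    and u1: "(\<integral>\<^sup>+ x\<in>\<Omega>. ennreal (\<bar>u x\<bar> powr p) \<partial>lebesgue) < \<infinity>"
    and u2: "(\<integral>\<^sup>+ z\<in>UNIV - (- \<Omega>) \<times> (- \<Omega>).
        ennreal (\<bar>u (fst z) - u (snd z)\<bar> powr p / norm (fst z - snd z) powr (real CARD('n) + p * s))
        \<partial>lebesgue) < \<infinity>"
    using u by (auto simp: Xsp_def)
  define N where "N = real CARD('n) + p * s"
  define \<phi> where "\<phi> x = v x * \<eta> x" for x
  have "(\<integral>\<^sup>+ x\<in>\<Omega>. ennreal (\<bar>\<phi> x\<bar> powr p) \<partial>lebesgue)
      \<le> (\<integral>\<^sup>+ x. ennreal (C powr p) * (ennreal (\<bar>u x\<bar> powr p) * indicator \<Omega> x) \<partial>lebesgue)"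
  proof (intro nn_integral_mono)
    fix x
    have "\<bar>\<phi> x\<bar> powr p \<le> (C * \<bar>u x\<bar>) powr p"
      unfolding \<phi>_def abs_mult using p mult_mono[OF v(2) \<eta>(2), of x x] C
      by (intro powr_mono2) (auto simp: mult.commute)
    also have "\<dots> = C powr p * \<bar>u x\<bar> powr p"
      using C by (simp add: powr_mult)
    finally show "ennreal (\<bar>\<phi> x\<bar> powr p) * indicator \<Omega> x
        \<le> ennreal (C powr p) * (ennreal (\<bar>u x\<bar> powr p) * indicator \<Omega> x)"
      by (auto simp: indicator_def ennreal_leI simp flip: ennreal_mult')
  qed
  also have "\<dots> = ennreal (C powr p) * (\<integral>\<^sup>+ x\<in>\<Omega>. ennreal (\<bar>u x\<bar> powr p) \<partial>lebesgue)"
    by (rule nn_integral_cmult) measurable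
  also have "\<dots> < \<infinity>" using u1 by (simp add: ennreal_mult_less_top)
  finally have 1: "(\<integral>\<^sup>+ x\<in>\<Omega>. ennreal (\<bar>\<phi> x\<bar> powr p) \<partial>lebesgue) < \<infinity>" .

  define A where "A = UNIV - (- \<Omega>) \<times> (- \<Omega>)"
  have A_eq: "A = fst -` \<Omega> \<union> snd -` \<Omega>" by (auto simp: A_def)
  have [measurable]: "A \<in> sets lebesgue"
    unfolding A_eq using measurable_sets[OF lebesgue_measurable_fst \<Omega>] measurable_sets[OF lebesgue_measurable_snd \<Omega>]
    by auto
  define f where "f x = ennreal (\<bar>u x\<bar> powr p) * indicator \<Omega> x" for x
  define k where "k h = ennreal (min (\<Lambda> * norm h) (2 * C) powr p / norm h powr N)" for h :: "real ^ 'n"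
  define U where "U z = ennreal (\<bar>u (fst z) - u (snd z)\<bar> powr p / norm (fst z - snd z) powr N) * indicator A z" for z
  have [measurable]: "f \<in> borel_measurable lebesgue" unfolding f_def[abs_def] by measurable
  have k_borel: "k \<in> borel_measurable borel" unfolding k_def[abs_def] by measurable
  then have k_leb: "k \<in> borel_measurable lebesgue" by (simp add: measurable_completion)
  have fm[measurable]: "(\<lambda>z :: (real ^ 'n) \<times> (real ^ 'n). f (fst z)) \<in> borel_measurable lebesgue"
    "(\<lambda>z :: (real ^ 'n) \<times> (real ^ 'n). f (snd z)) \<in> borel_measurable lebesgue"
    by measurable
  have km[measurable]: "(\<lambda>z. k (fst z - snd z)) \<in> borel_measurable lebesgue"
    using measurable_compose[OF lebesgue_measurable_fst_diff_snd k_leb] .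
  have nm[measurable]: "(\<lambda>z. norm (fst z - snd z)) \<in> borel_measurable (lebesgue :: ((real ^ 'n) \<times> (real ^ 'n)) measure)"
    by (intro measurable_completion) (simp add: borel_measurable_continuous_onI continuous_intros)
  have [measurable]: "U \<in> borel_measurable lebesgue"
    unfolding U_def[abs_def] by measurable
  have k_int: "(\<integral>\<^sup>+h. k h \<partial>lborel) < \<infinity>"
    unfolding k_def N_def using nn_integral_min_powr_kernel[where ?'a = "real ^ 'n", of "p * s" p \<Lambda> "2 * C"] s p C \<Lambda>
    by simp
  have fk: "(\<integral>\<^sup>+z. f (fst z) * k (fst z - snd z) \<partial>lebesgue) < \<infinity>"
    using u1 k_int by (subst nn_integral_lebesgue_product_kernel) (auto simp: f_def[symmetric] k_borel ennreal_mult_less_top)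
  have "(\<integral>\<^sup>+z. f (snd z) * k (fst z - snd z) \<partial>lebesgue)
      = (\<integral>\<^sup>+z. f (fst z) * k (snd z - fst z) \<partial>lebesgue)"
    by (subst nn_integral_lebesgue_swap[symmetric]) auto
  then have fk': "(\<integral>\<^sup>+z. f (snd z) * k (fst z - snd z) \<partial>lebesgue) < \<infinity>"
    using fk by (simp add: k_def norm_minus_commute)
  have eta2: "\<bar>\<eta> x - \<eta> y\<bar> \<le> min (\<Lambda> * norm (x - y)) (2 * C)" for x y
    using \<eta>(2)[of x] \<eta>(2)[of y] \<eta>(3)[of x y] by auto
  have main: "\<bar>\<phi> x - \<phi> y\<bar> powr p / norm (x - y) powr N
      \<le> 2 powr p * (C powr p * (\<bar>u x - u y\<bar> powr p / norm (x - y) powr N)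
        + \<bar>u x\<bar> powr p * (min (\<Lambda> * norm (x - y)) (2 * C) powr p / norm (x - y) powr N))" for x y
  proof -
    have "\<phi> x - \<phi> y = \<eta> y * (v x - v y) + v x * (\<eta> x - \<eta> y)"
      by (simp add: \<phi>_def algebra_simps)
    then have "\<bar>\<phi> x - \<phi> y\<bar> \<le> \<bar>\<eta> y * (v x - v y)\<bar> + \<bar>v x * (\<eta> x - \<eta> y)\<bar>" by simp
    also have "\<dots> \<le> C * \<bar>u x - u y\<bar> + \<bar>u x\<bar> * min (\<Lambda> * norm (x - y)) (2 * C)"
      unfolding abs_mult by (intro add_mono mult_mono v \<eta> eta2) (use C in auto)
    finally have "\<bar>\<phi> x - \<phi> y\<bar> powr p
      \<le> 2 powr p * ((C * \<bar>u x - u y\<bar>) powr p + (\<bar>u x\<bar> * min (\<Lambda> * norm (x - y)) (2 * C)) powr p)"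
      using C \<Lambda> p by (intro powr_abs_le_add) auto
    also have "\<dots> = 2 powr p * (C powr p * \<bar>u x - u y\<bar> powr p + \<bar>u x\<bar> powr p * min (\<Lambda> * norm (x - y)) (2 * C) powr p)"
      using C \<Lambda> by (simp add: powr_mult)
    finally have "\<bar>\<phi> x - \<phi> y\<bar> powr p / norm (x - y) powr N
      \<le> 2 powr p * (C powr p * \<bar>u x - u y\<bar> powr p + \<bar>u x\<bar> powr p * min (\<Lambda> * norm (x - y)) (2 * C) powr p) / norm (x - y) powr N"
      by (rule divide_right_mono) simp
    then show ?thesis by (simp only: times_divide_eq_right add_divide_distrib[symmetric])
  qed
  have split: "ennreal (c * (d * e + e' * e'')) = ennreal c * (ennreal d * ennreal e + ennreal e' * ennreal e'')"
    if "0 \<le> c" "0 \<le> d" "0 \<le> e" "0 \<le> e'" "0 \<le> e''" for c d e e' e'' :: real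
    using that by (simp add: ennreal_mult' ennreal_plus)
  have main': "ennreal (\<bar>\<phi> x - \<phi> y\<bar> powr p / norm (x - y) powr N)
      \<le> ennreal (2 powr p) * (ennreal (C powr p) * ennreal (\<bar>u x - u y\<bar> powr p / norm (x - y) powr N)
        + ennreal (\<bar>u x\<bar> powr p) * k (x - y))" for x y
    using ennreal_leI[OF main[of x y]] unfolding k_def by (subst (asm) split) auto
  \<comment> \<open>The p-th power of \<open>u\<close> is integrable over \<open>\<Omega>\<close>
    only, so the weight must sit at a coordinate lying in \<open>\<Omega>\<close>. If that is the
    second coordinate, the splitting is used with exchanged roles.\<close>
  have main_fst: "ennreal (\<bar>\<phi> (fst z) - \<phi> (snd z)\<bar> powr p / norm (fst z - snd z) powr N)
      \<le> ennreal (2 powr p) * (ennreal (C powr p) * U z + f (fst z) * k (fst z - snd z))" if "fst z \<in> \<Omega>" for z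
  proof -
    have "z \<in> A" using that by (auto simp: A_eq)
    then show ?thesis
      using main'[of "fst z" "snd z"] that by (simp add: U_def f_def)
  qed
  have main_snd: "ennreal (\<bar>\<phi> (fst z) - \<phi> (snd z)\<bar> powr p / norm (fst z - snd z) powr N)
      \<le> ennreal (2 powr p) * (ennreal (C powr p) * U z + f (snd z) * k (fst z - snd z))" if "snd z \<in> \<Omega>" for z
  proof -
    have "z \<in> A" using that by (auto simp: A_eq)
    then show ?thesis
      using main'[of "snd z" "fst z"] that
      by (simp add: U_def f_def k_def abs_minus_commute norm_minus_commute)
  qed
  have "(\<integral>\<^sup>+ z\<in>A. ennreal (\<bar>\<phi> (fst z) - \<phi> (snd z)\<bar> powr p / norm (fst z - snd z) powr N) \<partial>lebesgue)
    \<le> (\<integral>\<^sup>+ z. ennreal (2 powr p) * (ennreal (C powr p) * U z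
          + f (fst z) * k (fst z - snd z) + f (snd z) * k (fst z - snd z)) \<partial>lebesgue)"
  proof (rule nn_integral_mono)
    fix z
    show "ennreal (\<bar>\<phi> (fst z) - \<phi> (snd z)\<bar> powr p / norm (fst z - snd z) powr N) * indicator A z
      \<le> ennreal (2 powr p) * (ennreal (C powr p) * U z
          + f (fst z) * k (fst z - snd z) + f (snd z) * k (fst z - snd z))"
    proof (cases "z \<in> A")
      case True
      then consider "fst z \<in> \<Omega>" | "snd z \<in> \<Omega>" by (auto simp: A_eq)
      then show ?thesis
      proof cases
        case 1
        show ?thesis using True
          by (auto intro!: order_trans[OF main_fst[OF 1]] mult_left_mono)
      next
        case 2
        show ?thesis using True
          by (auto intro!: order_trans[OF main_snd[OF 2]] mult_left_mono add_right_mono)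
      qed
    qed simp
  qed
  also have "\<dots> = ennreal (2 powr p) * (ennreal (C powr p) * (\<integral>\<^sup>+z. U z \<partial>lebesgue)
      + (\<integral>\<^sup>+z. f (fst z) * k (fst z - snd z) \<partial>lebesgue) + (\<integral>\<^sup>+z. f (snd z) * k (fst z - snd z) \<partial>lebesgue))"
    by (simp add: nn_integral_cmult nn_integral_add)
  also have "\<dots> < \<infinity>"
    using u2 fk fk' by (simp add: ennreal_mult_less_top U_def A_def N_def)
  finally show ?thesis
    using 1 \<eta>0 by (auto simp: Xsp0_def Xsp_def A_def N_def \<phi>_def)
qed

lemma mult_cutoff_in_LpV:
  assumes p: "1 < p" and \<Omega>: "\<Omega> \<in> sets lebesgue" and u: "u \<in> LpV p V \<Omega>"
    and V: "V \<in> borel_measurable lebesgue"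
    and v: "v \<in> borel_measurable lebesgue" "\<And>x. \<bar>v x\<bar> \<le> \<bar>u x\<bar>"
    and \<eta>: "\<eta> \<in> borel_measurable lebesgue" "\<And>x. \<bar>\<eta> x\<bar> \<le> C" and C: "0 \<le> C"
  shows "(\<lambda>x. v x * \<eta> x) \<in> LpV p V \<Omega>"
proof -
  note [measurable] = v(1) \<eta>(1) \<Omega> V
  have um[measurable]: "u \<in> borel_measurable lebesgue" using u by (auto simp: LpV_def)
  have *: "(\<integral>\<^sup>+ x\<in>\<Omega>. ennreal (\<bar>v x * \<eta> x\<bar> powr p * P x) \<partial>lebesgue) < \<infinity>"
    if fin: "(\<integral>\<^sup>+ x\<in>\<Omega>. ennreal (\<bar>u x\<bar> powr p * P x) \<partial>lebesgue) < \<infinity>"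
      and P[measurable]: "P \<in> borel_measurable lebesgue" and P0: "\<And>x. 0 \<le> P x" for P
  proof -
    have "(\<integral>\<^sup>+ x\<in>\<Omega>. ennreal (\<bar>v x * \<eta> x\<bar> powr p * P x) \<partial>lebesgue)
      \<le> (\<integral>\<^sup>+ x. ennreal (C powr p) * (ennreal (\<bar>u x\<bar> powr p * P x) * indicator \<Omega> x) \<partial>lebesgue)"
    proof (intro nn_integral_mono)
      fix x
      have "\<bar>v x * \<eta> x\<bar> powr p \<le> (C * \<bar>u x\<bar>) powr p"
        unfolding abs_mult using p mult_mono[OF v(2) \<eta>(2), of x x] C
        by (intro powr_mono2) (auto simp: mult.commute)
      also have "\<dots> = C powr p * \<bar>u x\<bar> powr p"
        using C by (simp add: powr_mult)
      finally have "\<bar>v x * \<eta> x\<bar> powr p * P x \<le> C powr p * \<bar>u x\<bar> powr p * P x"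
        by (rule mult_right_mono) (rule P0)
      then show "ennreal (\<bar>v x * \<eta> x\<bar> powr p * P x) * indicator \<Omega> x
          \<le> ennreal (C powr p) * (ennreal (\<bar>u x\<bar> powr p * P x) * indicator \<Omega> x)"
        by (auto simp: indicator_def ennreal_leI mult.assoc simp flip: ennreal_mult')
    qed
    also have "\<dots> = ennreal (C powr p) * (\<integral>\<^sup>+ x\<in>\<Omega>. ennreal (\<bar>u x\<bar> powr p * P x) \<partial>lebesgue)"
      by (rule nn_integral_cmult) measurable
    also have "\<dots> < \<infinity>" using fin by (simp add: ennreal_mult_less_top)
    finally show ?thesis .
  qed
  have [measurable]: "pos_part V \<in> borel_measurable lebesgue" "neg_part V \<in> borel_measurable lebesgue"
    unfolding pos_part_def[abs_def] neg_part_def[abs_def] by measurable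
  show ?thesis
    using u *[of "pos_part V"] *[of "neg_part V"]
    by (auto simp: LpV_def pos_part_def neg_part_def)
qed

subsection \<open>The energy form\<close>

lemma admissible_kernelD:
  fixes K :: "real ^ 'n \<Rightarrow> real"
  assumes "admissible_kernel s p l L K"
  shows "K \<in> borel_measurable lebesgue"
    and "y \<noteq> 0 \<Longrightarrow> 0 < K y"
    and "y \<noteq> 0 \<Longrightarrow> K (- y) = K y"
    and "y \<noteq> 0 \<Longrightarrow> K y \<le> kernel_const CARD('n) p s * L / norm y powr (real CARD('n) + p * s)"
  using assms unfolding admissible_kernel_def by metis+

lemma lebesgue_measurable_diff_kernel:
  fixes K :: "real ^ 'n \<Rightarrow> real"
  assumes "K \<in> borel_measurable lebesgue"
  shows "(\<lambda>z. K (fst z - snd z)) \<in> borel_measurable lebesgue"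
  using measurable_compose[OF lebesgue_measurable_fst_diff_snd assms] .

text \<open>\<open>Hp\<close> grows like the power p - 1, so the integrand is dominated by the
  energy densities of \<open>u\<close> and \<open>\<phi>\<close>. The energy of \<open>u\<close> is
  finite only over pairs meeting \<open>\<Omega>\<close>; on all other pairs \<open>\<phi>\<close>
  vanishes at both points.\<close>

lemma energy_form_integrable:
  fixes u \<phi> :: "real ^ 'n \<Rightarrow> real"
  assumes p: "1 < p" and K: "admissible_kernel s p l L K"
    and \<Omega>: "\<Omega> \<in> sets lebesgue" and u: "u \<in> Xsp s p \<Omega>" and \<phi>: "\<phi> \<in> Xsp s p \<Omega>"
    and \<phi>0: "\<And>x. x \<notin> \<Omega> \<Longrightarrow> \<phi> x = 0"
  shows "integrable lebesgue (\<lambda>z. Hp p (u (fst z) - u (snd z)) * (\<phi> (fst z) - \<phi> (snd z)) * K (fst z - snd z))"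
proof (rule integrableI_bounded)
  have [measurable]: "u \<in> borel_measurable lebesgue" "\<phi> \<in> borel_measurable lebesgue"
    using u \<phi> by (auto simp: Xsp_def)
  have [measurable]: "(\<lambda>z. K (fst z - snd z)) \<in> borel_measurable lebesgue"
    by (intro lebesgue_measurable_diff_kernel admissible_kernelD[OF K])
  show "(\<lambda>z. Hp p (u (fst z) - u (snd z)) * (\<phi> (fst z) - \<phi> (snd z)) * K (fst z - snd z))
      \<in> borel_measurable lebesgue"
    unfolding Hp_def by measurable
  define N where "N = real CARD('n) + p * s"
  define c where "c = kernel_const CARD('n) p s * L"
  define A where "A = UNIV - (- \<Omega>) \<times> (- \<Omega>)"
  have A_eq: "A = fst -` \<Omega> \<union> snd -` \<Omega>" by (auto simp: A_def)
  have [measurable]: "A \<in> sets lebesgue"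
    unfolding A_eq using measurable_sets[OF lebesgue_measurable_fst \<Omega>] measurable_sets[OF lebesgue_measurable_snd \<Omega>]
    by auto
  define G where "G v z = ennreal (\<bar>v (fst z) - v (snd z)\<bar> powr p / norm (fst z - snd z) powr N) * indicator A z"
    for v :: "real ^ 'n \<Rightarrow> real" and z
  have nm[measurable]: "(\<lambda>z. norm (fst z - snd z)) \<in> borel_measurable (lebesgue :: ((real ^ 'n) \<times> (real ^ 'n)) measure)"
    by (intro measurable_completion) (simp add: borel_measurable_continuous_onI continuous_intros)
  have [measurable]: "G u \<in> borel_measurable lebesgue" "G \<phi> \<in> borel_measurable lebesgue"
    unfolding G_def[abs_def] by measurable
  have fin: "(\<integral>\<^sup>+z. G u z \<partial>lebesgue) < \<infinity>" "(\<integral>\<^sup>+z. G \<phi> z \<partial>lebesgue) < \<infinity>"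
    using u \<phi> by (auto simp: Xsp_def G_def A_def N_def)
  \<comment> \<open>Read off at a single nonzero vector, where the kernel is positive and bounded by
    \<open>c / norm y powr N\<close>.\<close>
  have c: "0 < c"
  proof -
    have "axis undefined 1 \<noteq> (0 :: real ^ 'n)" by simp
    from admissible_kernelD(2,4)[OF K this]
    have "0 < c / norm (axis undefined 1 :: real ^ 'n) powr N"
      unfolding c_def N_def by (rule less_le_trans)
    then show ?thesis by simp
  qed
  have "(\<integral>\<^sup>+z. ennreal (norm (Hp p (u (fst z) - u (snd z)) * (\<phi> (fst z) - \<phi> (snd z)) * K (fst z - snd z))) \<partial>lebesgue)
      \<le> (\<integral>\<^sup>+z. ennreal c * (G u z + G \<phi> z) \<partial>lebesgue)"
  proof (rule nn_integral_mono)
    fix z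
    show "ennreal (norm (Hp p (u (fst z) - u (snd z)) * (\<phi> (fst z) - \<phi> (snd z)) * K (fst z - snd z)))
        \<le> ennreal c * (G u z + G \<phi> z)"
    proof (cases "z \<in> A \<and> fst z \<noteq> snd z")
      case True
      define a b n where "a = u (fst z) - u (snd z)" and "b = \<phi> (fst z) - \<phi> (snd z)"
        and "n = norm (fst z - snd z) powr N"
      have Kz: "0 \<le> K (fst z - snd z)" "K (fst z - snd z) \<le> c / n"
        using admissible_kernelD(2,4)[OF K, of "fst z - snd z"] True
        by (simp_all add: c_def N_def n_def)
      have "norm (Hp p a * b * K (fst z - snd z)) = \<bar>a\<bar> powr (p - 1) * \<bar>b\<bar> * K (fst z - snd z)"
        using Kz by (simp add: abs_mult abs_Hp)
      also have "\<dots> \<le> (\<bar>a\<bar> powr p + \<bar>b\<bar> powr p) * (c / n)"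
        using p by (intro mult_mono Kz powr_mult_le_add) auto
      also have "\<dots> = c * (\<bar>a\<bar> powr p / n + \<bar>b\<bar> powr p / n)"
        by (simp add: algebra_simps add_divide_distrib)
      finally have "norm (Hp p a * b * K (fst z - snd z)) \<le> c * (\<bar>a\<bar> powr p / n + \<bar>b\<bar> powr p / n)" .
      moreover have "ennreal (c * (\<bar>a\<bar> powr p / n + \<bar>b\<bar> powr p / n)) = ennreal c * (G u z + G \<phi> z)"
        using True c by (simp add: G_def a_def b_def n_def ennreal_mult' ennreal_plus)
      ultimately show ?thesis
        using ennreal_leI unfolding a_def b_def by metis
    next
      case False
      then have "\<phi> (fst z) - \<phi> (snd z) = 0" using \<phi>0 by (auto simp: A_eq)
      then show ?thesis by simp
    qed
  qed
  also have "\<dots> = ennreal c * ((\<integral>\<^sup>+z. G u z \<partial>lebesgue) + (\<integral>\<^sup>+z. G \<phi> z \<partial>lebesgue))"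
    by (simp add: nn_integral_cmult nn_integral_add)
  also have "\<dots> < \<infinity>" using fin by (simp add: ennreal_mult_less_top)
  finally show "(\<integral>\<^sup>+z. ennreal (norm (Hp p (u (fst z) - u (snd z)) * (\<phi> (fst z) - \<phi> (snd z)) * K (fst z - snd z))) \<partial>lebesgue) < \<infinity>" .
qed

text \<open>Passes from a signed Bochner integral to extended nonnegative ones. If the integral of
  \<open>G\<close> is infinite, the claim is trivial; otherwise \<open>F + G\<close> is integrable
  and nonnegative, its two integrals agree, and \<open>a\<close> can be moved across.\<close>

lemma nn_integral_le_of_integral_le:
  fixes F D G :: "'a \<Rightarrow> real"
  assumes F: "integrable M F" and Fle: "(\<integral>z. F z \<partial>M) \<le> - a" and a: "0 \<le> a"
    and G: "G \<in> borel_measurable M" "\<And>z. 0 \<le> G z" and D: "\<And>z. 0 \<le> D z" "\<And>z. D z \<le> F z + G z"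
  shows "ennreal a + (\<integral>\<^sup>+z. ennreal (D z) \<partial>M) \<le> (\<integral>\<^sup>+z. ennreal (G z) \<partial>M)"
proof (cases "(\<integral>\<^sup>+z. ennreal (G z) \<partial>M) < \<infinity>")
  case True
  then have Gi: "integrable M G" using G by (intro integrableI_nonneg) auto
  have FG: "0 \<le> F z + G z" for z using D[of z] by linarith
  have "(\<integral>\<^sup>+z. ennreal (D z) \<partial>M) \<le> (\<integral>\<^sup>+z. ennreal (F z + G z) \<partial>M)"
    by (intro nn_integral_mono ennreal_leI D)
  also have "\<dots> = ennreal (\<integral>z. F z + G z \<partial>M)"
    using F Gi FG by (intro nn_integral_eq_integral) auto
  also have "(\<integral>z. F z + G z \<partial>M) = (\<integral>z. F z \<partial>M) + (\<integral>z. G z \<partial>M)"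
    using F Gi by simp
  finally have "ennreal a + (\<integral>\<^sup>+z. ennreal (D z) \<partial>M)
      \<le> ennreal a + ennreal ((\<integral>z. F z \<partial>M) + (\<integral>z. G z \<partial>M))"
    by (rule add_left_mono)
  also have "\<dots> = ennreal (a + ((\<integral>z. F z \<partial>M) + (\<integral>z. G z \<partial>M)))"
  proof (rule ennreal_plus[symmetric])
    show "0 \<le> (\<integral>z. F z \<partial>M) + (\<integral>z. G z \<partial>M)"
      using Bochner_Integration.integral_nonneg[of M "\<lambda>z. F z + G z"] FG F Gi by simp
  qed fact
  also have "\<dots> \<le> ennreal (\<integral>z. G z \<partial>M)" using Fle by (intro ennreal_leI) simp
  also have "\<dots> = (\<integral>\<^sup>+z. ennreal (G z) \<partial>M)"
    using Gi G by (intro nn_integral_eq_integral[symmetric]) auto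
  finally show ?thesis .
next
  case False
  then have "(\<integral>\<^sup>+z. ennreal (G z) \<partial>M) = top" by (simp add: not_less top_unique)
  then show ?thesis by simp
qed

text \<open>Tonelli leaves, for fixed \<open>x\<close>, an integral over the complement of
  \<open>B\<close>. It is below the supremum whenever \<open>\<eta> x\<close> is nonzero, and
  elsewhere the factor \<open>\<eta> x\<close> annihilates it. In the application
  \<open>\<eta>\<close> is the test function and \<open>S\<close> the support of the cutoff.\<close>

lemma nn_integral_tail_le:
  fixes K v \<eta> :: "real ^ 'n \<Rightarrow> real"
  assumes K[measurable]: "K \<in> borel_measurable lebesgue"
    and v[measurable]: "v \<in> borel_measurable lebesgue"
    and \<eta>[measurable]: "\<eta> \<in> borel_measurable lebesgue" and B[measurable]: "B \<in> sets lebesgue"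
    and f: "\<And>x. 0 \<le> \<eta> x" and S: "\<And>x. \<eta> x \<noteq> 0 \<Longrightarrow> x \<in> S"
    and v0: "\<And>y. 0 \<le> v y"
  shows "(\<integral>\<^sup>+z. ennreal (indicator B (fst z) * indicator (- B) (snd z) * (v (snd z) * (\<eta> (fst z) * K (fst z - snd z)))) \<partial>lebesgue)
    \<le> (SUP x\<in>S. \<integral>\<^sup>+y\<in>- B. ennreal (v y * K (x - y)) \<partial>lebesgue) * (\<integral>\<^sup>+x\<in>B. ennreal (\<eta> x) \<partial>lebesgue)"
proof -
  define S' where "S' = (SUP x\<in>S. \<integral>\<^sup>+y\<in>- B. ennreal (v y * K (x - y)) \<partial>lebesgue)"
  have "(\<integral>\<^sup>+z. ennreal (indicator B (fst z) * indicator (- B) (snd z) * (v (snd z) * (\<eta> (fst z) * K (fst z - snd z)))) \<partial>lebesgue)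
    = (\<integral>\<^sup>+z. (ennreal (\<eta> (fst z)) * indicator B (fst z)) * (ennreal (v (snd z)) * indicator (- B) (snd z))
        * ennreal (K (fst z - snd z)) \<partial>lebesgue)"
    using f v0 by (intro nn_integral_cong) (auto simp: indicator_def ennreal_mult' mult_ac)
  also have "\<dots> = (\<integral>\<^sup>+x. (ennreal (\<eta> x) * indicator B x)
      * (\<integral>\<^sup>+y. (ennreal (v y) * indicator (- B) y) * ennreal (K (x - y)) \<partial>lebesgue) \<partial>lebesgue)"
    by (rule nn_integral_lebesgue_convolution) auto
  also have "\<dots> \<le> (\<integral>\<^sup>+x. S' * (ennreal (\<eta> x) * indicator B x) \<partial>lebesgue)"
  proof (rule nn_integral_mono)
    fix x
    have "(\<integral>\<^sup>+y. (ennreal (v y) * indicator (- B) y) * ennreal (K (x - y)) \<partial>lebesgue)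
        = (\<integral>\<^sup>+y\<in>- B. ennreal (v y * K (x - y)) \<partial>lebesgue)"
      using v0 by (intro nn_integral_cong) (simp add: ennreal_mult' mult_ac)
    also have "\<dots> \<le> S'" if "\<eta> x \<noteq> 0" unfolding S'_def using S[OF that] by (rule SUP_upper)
    finally show "(ennreal (\<eta> x) * indicator B x)
        * (\<integral>\<^sup>+y. (ennreal (v y) * indicator (- B) y) * ennreal (K (x - y)) \<partial>lebesgue)
        \<le> S' * (ennreal (\<eta> x) * indicator B x)"
      by (cases "\<eta> x = 0") (auto simp: mult.commute[of S'] intro!: mult_left_mono)
  qed
  also have "\<dots> = S' * (\<integral>\<^sup>+x\<in>B. ennreal (\<eta> x) \<partial>lebesgue)"
    by (rule nn_integral_cmult) measurable
  finally show ?thesis unfolding S'_def .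
qed

subsection \<open>Potentials\<close>

text \<open>A dichotomy on the essential supremum of the inverse weight. If it is infinite,
  finiteness of the product forces the average of \<open>v\<close> to be zero; if it is finite,
  \<open>\<omega>\<close> is positive almost everywhere on \<open>Q\<close>, which excludes
  \<open>0 < v y\<close>.\<close>

lemma A1_pair_null:
  fixes v \<omega> :: "real ^ 'n \<Rightarrow> real"
  assumes A1: "A1_pair v \<omega>" and Q: "Q \<in> cubes"
    and \<omega>0: "\<And>y. 0 < v y \<Longrightarrow> \<omega> y \<le> 0"
  shows "AE y in lebesgue. y \<in> Q \<longrightarrow> v y \<le> 0"
proof -
  have [measurable]: "v \<in> borel_measurable lebesgue"
    using A1 by (auto simp: A1_pair_def is_weight_def Lq_loc_def)
  from Q obtain a h where Qdef: "Q = cbox a (\<chi> i. a $ i + h)" by (auto simp: cubes_def)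
  have Qm[measurable]: "Q \<in> sets lebesgue" by (simp add: Qdef)
  have Qfin: "emeasure lebesgue Q \<noteq> \<infinity>"
    using emeasure_lborel_cbox_finite[of a "\<chi> i. a $ i + h"] by (simp add: Qdef less_top)
  define R where "R = (\<integral>\<^sup>+ y\<in>Q. ennreal (v y) \<partial>lebesgue) / emeasure lebesgue Q"
  define E where "E = esssup (restrict_space lebesgue Q) (\<lambda>y. inverse (ennreal (\<omega> y)))"
  have "R * E \<le> (SUP Q\<in>cubes. ((\<integral>\<^sup>+ y\<in>Q. ennreal (v y) \<partial>lebesgue) / emeasure lebesgue Q)
        * esssup (restrict_space lebesgue Q) (\<lambda>y. inverse (ennreal (\<omega> y))))"
    unfolding R_def E_def using Q by (rule SUP_upper)
  also have "\<dots> < \<infinity>" using A1 by (simp add: A1_pair_def)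
  finally have RE: "R * E < \<infinity>" .
  show ?thesis
  proof (cases "E = top")
    case True
    then have "R = 0" using RE by (auto simp: ennreal_mult_less_top)
    then have "(\<integral>\<^sup>+ y\<in>Q. ennreal (v y) \<partial>lebesgue) = 0"
      using Qfin by (auto simp: R_def ennreal_divide_eq_0_iff)
    then have "AE y in lebesgue. ennreal (v y) * indicator Q y = 0"
      by (subst (asm) nn_integral_0_iff_AE) auto
    then show ?thesis
      by eventually_elim (auto simp: ennreal_eq_0_iff split: split_indicator_asm)
  next
    case False
    have "AE y in restrict_space lebesgue Q. inverse (ennreal (\<omega> y)) \<le> E"
      unfolding E_def by (rule esssup_AE)
    then have "AE y in lebesgue. y \<in> Q \<longrightarrow> inverse (ennreal (\<omega> y)) \<le> E"
      by (subst (asm) AE_restrict_space_iff) auto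
    then show ?thesis
    proof eventually_elim
      case (elim y)
      show ?case
      proof (intro impI leI notI)
        assume "y \<in> Q" "0 < v y"
        \<comment> \<open>\<open>ennreal\<close> sends nonpositive reals to 0, whose inverse is
          infinite.\<close>
        then have "inverse (ennreal (\<omega> y)) = top" using \<omega>0[of y] by (simp add: ennreal_neg)
        then show False using elim \<open>y \<in> Q\<close> False by (simp add: top_unique)
      qed
    qed
  qed
qed

text \<open>Where the negative part is positive, the positive part is 0, so the regularised weight
  at \<open>i = 1\<close> vanishes whatever \<open>b\<close> is there. Cubes centred at the origin
  then exhaust the space.\<close>

lemma potentials_nonneg_AE:
  fixes V :: "real ^ 'n \<Rightarrow> real"
  assumes "V \<in> potentials q"
  shows "AE y in lebesgue. 0 \<le> V y"
proof -
  obtain b where A1: "A1_pair (neg_part V) (pos_part_reg V b 1)"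
    using assms by (auto simp: potentials_def)
  \<comment> \<open>\<open>Suc k\<close> keeps the side length positive, as membership in
    \<open>cubes\<close> demands.\<close>
  define Q :: "nat \<Rightarrow> (real ^ 'n) set" where "Q k = cbox (\<chi> i. - real (Suc k)) (\<chi> i. real (Suc k))" for k
  have "Q k \<in> cubes" for k
  proof -
    have "Q k = cbox (\<chi> i. - real (Suc k)) (\<chi> i. (\<chi> i. - real (Suc k)) $ i + 2 * real (Suc k))"
      by (simp add: Q_def)
    then show ?thesis unfolding cubes_def
      by (intro CollectI exI conjI) (assumption, simp)
  qed
  then have "AE y in lebesgue. y \<in> Q k \<longrightarrow> neg_part V y \<le> 0" for k
    by (rule A1_pair_null[OF A1]) (auto simp: neg_part_def pos_part_reg_def pos_part_def)
  then have "AE y in lebesgue. \<forall>k. y \<in> Q k \<longrightarrow> neg_part V y \<le> 0"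
    unfolding AE_all_countable by blast
  then show ?thesis
  proof eventually_elim
    case (elim y)
    obtain k where "norm y \<le> real k" using real_arch_simple by blast
    then have "- real (Suc k) \<le> y $ i \<and> y $ i \<le> real (Suc k)" for i
      using component_le_norm_cart[of y i] by (simp add: abs_le_iff)
    then have "y \<in> Q k" by (simp add: Q_def mem_box_cart)
    then show ?case using elim by (auto simp: neg_part_def)
  qed
qed

subsection \<open>The Caccioppoli inequality\<close>

text \<open>The left side is a sum in \<open>ereal\<close> because the potential term is a real
  Bochner integral whose integrand has the sign of \<open>V\<close>, while the double integrals may
  be infinite.\<close>

theorem theorem1p5:
  fixes \<Omega> :: "(real ^ 'n) set"
    and K V g u \<zeta> w :: "real ^ 'n \<Rightarrow> real"
    and x0 :: "real ^ 'n"
    and s p q l L r M c\<^sub>p :: real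
    and B :: "(real ^ 'n) set"
  assumes dom: "bounded_lipschitz_domain \<Omega>"
    and s: "0 < s" "s < 1"
    and p: "1 < p"
    and q: "real CARD('n) / (p * s) < q" "1 < real CARD('n) / (p * s)"
    and ell: "0 < l" "l \<le> L"
    and K: "admissible_kernel s p l L K"
    and V: "V \<in> potentials q"
    and g: "g \<in> Wsp s p"
    and r: "0 < r" "ball x0 (2 * r) \<subseteq> \<Omega>"
    and u: "weak_subsolution s p K V \<Omega> g u"
    and M: "0 < M"
    and \<zeta>: "\<zeta> \<in> Cc_infinity (ball x0 r)" "\<And>x. 0 \<le> \<zeta> x"
  defines "B \<equiv> ball x0 r"
    and "w \<equiv> pos_part (\<lambda>y. u y - M)"
    and "c\<^sub>p \<equiv> 1 / 2 * (2 * (p - 1)) powr (p - 1)"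
  shows
    "ereal (LINT y:B|lebesgue. (w y * \<zeta> y) powr p * V y)
     + enn2ereal (\<integral>\<^sup>+ z\<in>B \<times> B.
         ennreal (\<bar>\<zeta> (fst z) * w (fst z) - \<zeta> (snd z) * w (snd z)\<bar> powr p * K (fst z - snd z)) \<partial>lebesgue)
     \<le> enn2ereal
        (ennreal (2 powr (2 * p + 1) * (1 / 4 + c\<^sub>p))
          * (\<integral>\<^sup>+ z\<in>B \<times> B.
              ennreal (max (w (fst z)) (w (snd z)) powr p * \<bar>\<zeta> (fst z) - \<zeta> (snd z)\<bar> powr p
                * K (fst z - snd z)) \<partial>lebesgue)
        + ennreal (2 powr (p + 2))
          * (SUP x\<in>supp \<zeta>. \<integral>\<^sup>+ y\<in>- B. ennreal (w y powr (p - 1) * K (x - y)) \<partial>lebesgue)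
          * (\<integral>\<^sup>+ y\<in>B. ennreal (w y * \<zeta> y powr p) \<partial>lebesgue))"
proof -

  \<comment> \<open>The test function and its admissibility\<close>
  have V_AE: "AE y in lebesgue. 0 \<le> V y" by (rule potentials_nonneg_AE[OF V])
  have \<Omega>[measurable]: "\<Omega> \<in> sets lebesgue"
    using dom by (simp add: bounded_lipschitz_domain_def)
  have B\<Omega>: "B \<subseteq> \<Omega>"
    using r subset_ball[of r "2 * r" x0] by (auto simp: B_def)
  have B[measurable]: "B \<in> sets lebesgue" by (simp add: B_def)
  have u_X: "u \<in> Xsp s p \<Omega>" and u_V: "u \<in> LpV p V \<Omega>"
    and sub: "\<And>\<phi>. \<phi> \<in> Ysp0 s p V \<Omega> \<Longrightarrow> (\<And>x. 0 \<le> \<phi> x) \<Longrightarrow>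
        (LINT (x, y)|lebesgue. Hp p (u x - u y) * (\<phi> x - \<phi> y) * K (x - y)) +
        (LINT x|lebesgue. V x * (\<bar>u x\<bar> powr (p - 2) * u x) * \<phi> x) \<le> 0"
    using u by (auto simp: weak_subsolution_def Yspg_minus_def Ysp_def)
  have [measurable]: "u \<in> borel_measurable lebesgue" using u_X by (simp add: Xsp_def)
  have pn[measurable]: "pos_part V \<in> borel_measurable lebesgue" "neg_part V \<in> borel_measurable lebesgue"
    using V by (auto simp: potentials_def Lq_loc_def)
  have "V = (\<lambda>x. pos_part V x - neg_part V x)"
    by (auto simp: pos_part_def neg_part_def max_def)
  then have V_meas[measurable]: "V \<in> borel_measurable lebesgue"
    using pn borel_measurable_diff by metis
  note K_meas[measurable] = admissible_kernelD(1)[OF K]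
  have Kz_meas[measurable]: "(\<lambda>z. K (fst z - snd z)) \<in> borel_measurable lebesgue"
    by (rule lebesgue_measurable_diff_kernel[OF K_meas])
  have w_meas[measurable]: "w \<in> borel_measurable lebesgue"
    unfolding w_def pos_part_def[abs_def] by measurable
  have w0: "0 \<le> w x" for x by (simp add: w_def pos_part_def)
  \<comment> \<open>Here \<open>0 < M\<close> enters: where \<open>w x\<close> is positive it equals
    \<open>u x - M\<close>, which lies below \<open>u x\<close>.\<close>
  have w_le: "\<bar>w x\<bar> \<le> \<bar>u x\<bar>" for x using M by (auto simp: w_def pos_part_def)
  have w_diff: "\<bar>w x - w y\<bar> \<le> \<bar>u x - u y\<bar>" for x y by (auto simp: w_def pos_part_def)
  have \<zeta>0: "\<zeta> x = 0" if "x \<notin> B" for x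
    using Cc_infinity_zero[OF \<zeta>(1)] that by (simp add: B_def)
  obtain c where c: "0 \<le> c" "\<And>x. \<bar>\<zeta> x\<bar> \<le> c" using Cc_infinity_bounded[OF \<zeta>(1)] by blast
  obtain \<Lambda> where \<Lambda>: "0 \<le> \<Lambda>" "\<And>x y. \<bar>\<zeta> x - \<zeta> y\<bar> \<le> \<Lambda> * norm (x - y)"
    using Cc_infinity_lipschitz[OF \<zeta>(1)] by blast
  have \<zeta>_meas[measurable]: "\<zeta> \<in> borel_measurable lebesgue"
    using Cc_infinity_continuous[OF \<zeta>(1)] by (intro measurable_completion) (simp add: borel_measurable_continuous_onI)
  define \<eta> where "\<eta> x = \<zeta> x powr p" for x
  have \<eta>_meas[measurable]: "\<eta> \<in> borel_measurable lebesgue" unfolding \<eta>_def[abs_def] by measurable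
  have \<eta>_nn: "0 \<le> \<eta> x" for x by (simp add: \<eta>_def)
  have \<eta>0: "\<eta> x = 0" if "x \<notin> B" for x using \<zeta>0[OF that] by (simp add: \<eta>_def)
  have \<eta>_le: "\<bar>\<eta> x\<bar> \<le> c powr p" for x
    using c(2)[of x] \<zeta>(2)[of x] p by (auto simp: \<eta>_def intro: powr_mono2)
  have \<eta>_lip: "\<bar>\<eta> x - \<eta> y\<bar> \<le> (p * c powr (p - 1) * \<Lambda>) * norm (x - y)" for x y
  proof -
    have "\<bar>\<eta> x - \<eta> y\<bar> \<le> p * c powr (p - 1) * \<bar>\<zeta> x - \<zeta> y\<bar>"
      unfolding \<eta>_def using c(2)[of x] c(2)[of y] \<zeta>(2) p by (intro abs_powr_diff_le) auto
    also have "\<dots> \<le> p * c powr (p - 1) * (\<Lambda> * norm (x - y))"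
      using p by (intro mult_left_mono \<Lambda>) auto
    finally show ?thesis by (simp add: mult.assoc)
  qed
  define \<phi> where "\<phi> x = w x * \<eta> x" for x
  have \<phi>_meas[measurable]: "\<phi> \<in> borel_measurable lebesgue" unfolding \<phi>_def[abs_def] by measurable
  have \<phi>_nn: "0 \<le> \<phi> x" for x using w0 \<eta>_nn by (simp add: \<phi>_def)
  have \<phi>0: "\<phi> x = 0" if "x \<notin> B" for x using \<eta>0[OF that] by (simp add: \<phi>_def)
  have \<phi>_X0: "\<phi> \<in> Xsp0 s p \<Omega>"
    unfolding \<phi>_def[abs_def]
    by (rule mult_cutoff_in_Xsp0[OF s p \<Omega> u_X w_meas w_le w_diff \<eta>_meas \<eta>_le \<eta>_lip])
       (use \<eta>0 B\<Omega> \<Lambda> p in auto)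
  moreover have "\<phi> \<in> LpV p V \<Omega>"
    unfolding \<phi>_def[abs_def]
    by (rule mult_cutoff_in_LpV[OF p \<Omega> u_V V_meas w_meas w_le \<eta>_meas \<eta>_le]) simp
  ultimately have \<phi>_Y0: "\<phi> \<in> Ysp0 s p V \<Omega>" by (simp add: Ysp0_def)

  \<comment> \<open>The tested inequality and its potential term\<close>
  define E where "E z = Hp p (u (fst z) - u (snd z)) * (\<phi> (fst z) - \<phi> (snd z)) * K (fst z - snd z)" for z
  have E_int: "integrable lebesgue E"
    unfolding E_def[abs_def]
    by (rule energy_form_integrable[OF p K \<Omega> u_X]) (use \<phi>_X0 \<phi>0 B\<Omega> in \<open>auto simp: Xsp0_def\<close>)
  \<comment> \<open>Membership in \<open>LpV\<close> makes \<open>H\<close> integrable, and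
    \<open>c powr p * H\<close> dominates the potential term of the tested inequality, whose Bochner
    integral is therefore not a default zero.\<close>
  define H where "H x = indicator \<Omega> x * (\<bar>u x\<bar> powr p * \<bar>V x\<bar>)" for x
  have H_int: "integrable lebesgue H"
  proof (rule integrableI_bounded)
    show "H \<in> borel_measurable lebesgue" unfolding H_def[abs_def] by measurable
    have "(\<integral>\<^sup>+x. ennreal (norm (H x)) \<partial>lebesgue)
        = (\<integral>\<^sup>+x. ennreal (\<bar>u x\<bar> powr p * pos_part V x) * indicator \<Omega> x
            + ennreal (\<bar>u x\<bar> powr p * neg_part V x) * indicator \<Omega> x \<partial>lebesgue)"
    proof (rule nn_integral_cong)
      fix x
      show "ennreal (norm (H x)) = ennreal (\<bar>u x\<bar> powr p * pos_part V x) * indicator \<Omega> x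
          + ennreal (\<bar>u x\<bar> powr p * neg_part V x) * indicator \<Omega> x"
        by (cases "0 \<le> V x") (auto simp: H_def abs_mult pos_part_def neg_part_def split: split_indicator)
    qed
    also have "\<dots> = (\<integral>\<^sup>+x\<in>\<Omega>. ennreal (\<bar>u x\<bar> powr p * pos_part V x) \<partial>lebesgue)
        + (\<integral>\<^sup>+x\<in>\<Omega>. ennreal (\<bar>u x\<bar> powr p * neg_part V x) \<partial>lebesgue)"
      by (intro nn_integral_add) measurable
    also have "\<dots> < \<infinity>" using u_V by (simp add: LpV_def)
    finally show "(\<integral>\<^sup>+x. ennreal (norm (H x)) \<partial>lebesgue) < \<infinity>" .
  qed
  \<comment> \<open>\<open>P\<close> is the potential integrand of the claim, \<open>Q\<close> that
    of the tested inequality; they are compared where \<open>V\<close> is nonnegative, that is,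
    almost everywhere.\<close>
  define P where "P x = indicator B x * ((w x * \<zeta> x) powr p * V x)" for x
  define Q where "Q x = V x * (\<bar>u x\<bar> powr (p - 2) * u x) * \<phi> x" for x
  have Q_int: "integrable lebesgue Q"
  proof (rule Bochner_Integration.integrable_bound)
    show "integrable lebesgue (\<lambda>x. c powr p * H x)" using H_int by simp
    show "Q \<in> borel_measurable lebesgue" unfolding Q_def[abs_def] by measurable
    show "AE x in lebesgue. norm (Q x) \<le> norm (c powr p * H x)"
    proof (rule AE_I2)
      fix x
      show "norm (Q x) \<le> norm (c powr p * H x)"
      proof (cases "x \<in> \<Omega>")
        case True
        have "norm (Q x) = \<bar>V x\<bar> * \<bar>u x\<bar> powr (p - 1) * (\<bar>w x\<bar> * \<bar>\<eta> x\<bar>)"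
          using abs_Hp[of p "u x"] by (simp add: Q_def \<phi>_def Hp_def abs_mult)
        also have "\<dots> \<le> \<bar>V x\<bar> * \<bar>u x\<bar> powr (p - 1) * (\<bar>u x\<bar> * c powr p)"
          by (intro mult_left_mono mult_mono w_le \<eta>_le) auto
        also have "\<dots> = norm (c powr p * H x)"
          using True powr_minus_one_mult[of "\<bar>u x\<bar>" p] by (simp add: H_def abs_mult mult_ac)
        finally show ?thesis .
      next
        case False
        then have "\<phi> x = 0" using B\<Omega> by (intro \<phi>0) auto
        then show ?thesis by (simp add: Q_def)
      qed
    qed
  qed
  have PQ: "0 \<le> P x" "P x \<le> Q x" if "0 \<le> V x" for x
  proof -
    show "0 \<le> P x" using that by (simp add: P_def)
    have "(w x * \<zeta> x) powr p * V x \<le> Q x"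
      using potential_term_le[OF p M \<zeta>(2)[of x] that, of "u x"]
      by (simp add: Q_def \<phi>_def w_def pos_part_def \<eta>_def)
    then show "P x \<le> Q x" using \<phi>0[of x] by (cases "x \<in> B") (auto simp: P_def Q_def)
  qed
  have P_int: "integrable lebesgue P"
  proof (rule Bochner_Integration.integrable_bound[OF Q_int])
    show "P \<in> borel_measurable lebesgue" unfolding P_def[abs_def] by measurable
    show "AE x in lebesgue. norm (P x) \<le> norm (Q x)"
      using V_AE by eventually_elim (use PQ in \<open>force simp: abs_of_nonneg\<close>)
  qed
  define A where "A = (LINT y:B|lebesgue. (w y * \<zeta> y) powr p * V y)"
  have A_eq: "A = (\<integral>x. P x \<partial>lebesgue)" by (simp add: A_def P_def[abs_def] set_lebesgue_integral_def)
  have A0: "0 \<le> A"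
    unfolding A_eq by (rule integral_nonneg_AE) (use V_AE PQ in \<open>auto elim: eventually_mono\<close>)
  have "A \<le> (\<integral>x. Q x \<partial>lebesgue)"
    unfolding A_eq by (rule integral_mono_AE[OF P_int Q_int]) (use V_AE PQ in \<open>auto elim: eventually_mono\<close>)
  with sub[OF \<phi>_Y0 \<phi>_nn] have EA: "(\<integral>z. E z \<partial>lebesgue) \<le> - A"
    by (simp add: E_def[abs_def] Q_def[abs_def] case_prod_beta')

  \<comment> \<open>Pointwise comparison on the product space\<close>
  define \<mu> :: real where "\<mu> = 2 powr (p + 1)"
  have \<mu>1: "1 \<le> \<mu>" using p by (simp add: \<mu>_def ge_one_powr_ge_zero)
  define \<kappa> where "\<kappa> = \<mu> * (1 / 2 + (2 * (p - 1)) powr (p - 1))"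
  have \<kappa>0: "0 \<le> \<kappa>" using \<mu>1 by (simp add: \<kappa>_def)
  define D where "D z = indicator (B \<times> B) z
    * (\<bar>\<zeta> (fst z) * w (fst z) - \<zeta> (snd z) * w (snd z)\<bar> powr p * K (fst z - snd z))" for z
  define R where "R z = indicator (B \<times> B) z
    * (max (w (fst z)) (w (snd z)) powr p * \<bar>\<zeta> (fst z) - \<zeta> (snd z)\<bar> powr p * K (fst z - snd z))" for z
  \<comment> \<open>Covers the pairs leaving \<open>B\<close> from the first to the second
    coordinate; the reverse pairs are covered by \<open>T (snd z, fst z)\<close>.\<close>
  define T where "T z = indicator B (fst z) * indicator (- B) (snd z)
    * (w (snd z) powr (p - 1) * (\<phi> (fst z) * K (fst z - snd z)))" for z
  have BB: "B \<times> B = fst -` B \<inter> snd -` B" by auto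
  have [measurable]: "B \<times> B \<in> sets lebesgue"
    unfolding BB using measurable_sets[OF lebesgue_measurable_fst B] measurable_sets[OF lebesgue_measurable_snd B]
    by auto
  have R_meas[measurable]: "R \<in> borel_measurable lebesgue" unfolding R_def[abs_def] by measurable
  have T_meas[measurable]: "T \<in> borel_measurable lebesgue" unfolding T_def[abs_def] by measurable
  have Ts_meas[measurable]: "(\<lambda>z. T (snd z, fst z)) \<in> borel_measurable lebesgue"
    using measurable_compose[OF lebesgue_measurable_swap T_meas] .
  have D0: "0 \<le> D z" and R0: "0 \<le> R z" and T0: "0 \<le> T z" for z
  proof -
    \<comment> \<open>The kernel has no prescribed sign at the origin, but on the diagonal the
      factor in front of it is 0 in \<open>D\<close>, \<open>R\<close> and \<open>T\<close>.\<close>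
    have Kp: "0 \<le> K (fst z - snd z)" if "fst z \<noteq> snd z"
      using admissible_kernelD(2)[OF K, of "fst z - snd z"] that by simp
    show "0 \<le> D z" using Kp by (cases "fst z = snd z") (auto simp: D_def)
    show "0 \<le> R z" using Kp by (cases "fst z = snd z") (auto simp: R_def)
    show "0 \<le> T z" using Kp \<phi>_nn by (cases "fst z = snd z") (auto simp: T_def indicator_def)
  qed
  define G where "G z = \<kappa> * R z + \<mu> * (T z + T (snd z, fst z))" for z
  have DG: "D z \<le> \<mu> * E z + G z" for z
  proof (cases "fst z = snd z")
    case True
    then show ?thesis using \<kappa>0 \<mu>1 R0 T0 by (simp add: D_def E_def G_def)
  next
    case False
    obtain x y where z: "z = (x, y)" by (cases z)
    with False have xy: "x \<noteq> y" by simp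
    have Kp: "0 \<le> K (x - y)" and Ksym: "K (y - x) = K (x - y)"
      using admissible_kernelD(2,3)[OF K, of "x - y"] xy by simp_all
    have ux: "max (u x - M) 0 = w x" for x by (simp add: w_def pos_part_def)
    consider "x \<in> B" "y \<in> B" | "x \<in> B" "y \<notin> B" | "x \<notin> B" "y \<in> B" | "x \<notin> B" "y \<notin> B" by blast
    then show ?thesis
    proof cases
      case 1
      have "D z = \<bar>\<zeta> x * w x - \<zeta> y * w y\<bar> powr p * K (x - y)"
        using 1 by (simp add: D_def z)
      also have "\<dots> \<le> (\<mu> * (Hp p (u x - u y) * (\<phi> x - \<phi> y)
          + (1 / 2 + (2 * (p - 1)) powr (p - 1)) * (max (w x) (w y) powr p * \<bar>\<zeta> x - \<zeta> y\<bar> powr p))) * K (x - y)"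
        using caccioppoli_pointwise[OF p \<zeta>(2)[of x] \<zeta>(2)[of y], of "u x" M "u y"] Kp
        unfolding ux \<phi>_def \<eta>_def \<mu>_def by (intro mult_right_mono)
      also have "\<dots> = \<mu> * E z + \<kappa> * R z"
        using 1 by (simp add: E_def R_def z \<kappa>_def algebra_simps)
      also have "\<dots> \<le> \<mu> * E z + G z" using \<mu>1 T0 by (simp add: G_def)
      finally show ?thesis .
    next
      case 2
      have "- (Hp p (u x - u y) * \<phi> x) * K (x - y) \<le> (w y powr (p - 1) * \<phi> x) * K (x - y)"
        using tail_pointwise[OF p, of "u x" "u y" M "\<zeta> x"] Kp
        unfolding ux \<phi>_def \<eta>_def by (intro mult_right_mono)
      then have "0 \<le> E z + T z"
        using 2 \<phi>0[of y] by (simp add: E_def T_def z mult_ac)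
      then have "0 \<le> \<mu> * (E z + T z)" using \<mu>1 by simp
      moreover have "D z = 0" "0 \<le> \<kappa> * R z" "0 \<le> \<mu> * T (snd z, fst z)"
        using 2 \<kappa>0 \<mu>1 R0 T0 by (auto simp: D_def z)
      ultimately show ?thesis by (simp add: G_def distrib_left)
    next
      case 3
      have "- (Hp p (u y - u x) * \<phi> y) * K (x - y) \<le> (w x powr (p - 1) * \<phi> y) * K (x - y)"
        using tail_pointwise[OF p, of "u y" "u x" M "\<zeta> y"] Kp
        unfolding ux \<phi>_def \<eta>_def by (intro mult_right_mono)
      \<comment> \<open>The reflected strip carries \<open>K (y - x)\<close>; evenness of the kernel
        and oddness of \<open>Hp\<close> bring it back to the form of \<open>E z\<close>.\<close>
      then have "0 \<le> E z + T (snd z, fst z)"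
        using 3 \<phi>0[of x] Hp_minus[of p "u x - u y"] by (simp add: E_def T_def z Ksym mult_ac)
      then have "0 \<le> \<mu> * (E z + T (snd z, fst z))" using \<mu>1 by simp
      moreover have "D z = 0" "0 \<le> \<kappa> * R z" "0 \<le> \<mu> * T z"
        using 3 \<kappa>0 \<mu>1 R0 T0 by (auto simp: D_def z)
      ultimately show ?thesis by (simp add: G_def distrib_left)
    next
      case 4
      then show ?thesis using \<phi>0[of x] \<phi>0[of y] \<kappa>0 \<mu>1 R0 T0 by (simp add: D_def E_def G_def z)
    qed
  qed

  \<comment> \<open>Integration and constants\<close>
  define J where "J = (SUP x\<in>supp \<zeta>. \<integral>\<^sup>+ y\<in>- B. ennreal (w y powr (p - 1) * K (x - y)) \<partial>lebesgue)
    * (\<integral>\<^sup>+ y\<in>B. ennreal (w y * \<zeta> y powr p) \<partial>lebesgue)"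
  have T_le: "(\<integral>\<^sup>+z. ennreal (T z) \<partial>lebesgue) \<le> J"
    using nn_integral_tail_le[OF K_meas, of "\<lambda>y. w y powr (p - 1)" \<phi> B "supp \<zeta>"] \<phi>_nn closure_subset[of "{x. \<zeta> x \<noteq> 0}"]
    by (auto simp: J_def T_def \<phi>_def \<eta>_def supp_def)
  have "ennreal A + (\<integral>\<^sup>+z. ennreal (D z) \<partial>lebesgue) \<le> (\<integral>\<^sup>+z. ennreal (G z) \<partial>lebesgue)"
  proof (rule nn_integral_le_of_integral_le)
    show "integrable lebesgue (\<lambda>z. \<mu> * E z)" using E_int by simp
    have "\<mu> * (\<integral>z. E z \<partial>lebesgue) \<le> \<mu> * (- A)" using EA \<mu>1 by (intro mult_left_mono) auto
    \<comment> \<open>Scaling by \<open>\<mu>\<close> yields the potential term with factor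
      \<open>\<mu>\<close>; since \<open>A\<close> is nonnegative and \<open>\<mu>\<close> at least
      1, it may be lowered to factor 1.\<close>
    also have "\<dots> \<le> - A" using \<mu>1 A0 mult_right_mono[of 1 \<mu> A] by simp
    finally show "(\<integral>z. \<mu> * E z \<partial>lebesgue) \<le> - A" by simp
    show "G \<in> borel_measurable lebesgue" unfolding G_def[abs_def] by measurable
    show "0 \<le> G z" for z using R0 T0 \<kappa>0 \<mu>1 by (simp add: G_def)
  qed (use A0 D0 DG in auto)
  also have "(\<integral>\<^sup>+z. ennreal (G z) \<partial>lebesgue)
      = (\<integral>\<^sup>+z. ennreal \<kappa> * ennreal (R z) + ennreal \<mu> * (ennreal (T z) + ennreal (T (snd z, fst z))) \<partial>lebesgue)"
    using R0 T0 \<kappa>0 \<mu>1 by (intro nn_integral_cong) (simp add: G_def ennreal_mult' ennreal_plus)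
  also have "\<dots> = ennreal \<kappa> * (\<integral>\<^sup>+z. ennreal (R z) \<partial>lebesgue)
      + ennreal \<mu> * ((\<integral>\<^sup>+z. ennreal (T z) \<partial>lebesgue) + (\<integral>\<^sup>+z. ennreal (T (snd z, fst z)) \<partial>lebesgue))"
    by (simp add: nn_integral_add nn_integral_cmult)
  \<comment> \<open>Both strips have the same integral, so the tail carries
    \<open>2 * \<mu> = 2 powr (p + 2)\<close>.\<close>
  also have "(\<integral>\<^sup>+z. ennreal (T (snd z, fst z)) \<partial>lebesgue) = (\<integral>\<^sup>+z. ennreal (T z) \<partial>lebesgue)"
    using nn_integral_lebesgue_swap[of "\<lambda>z. ennreal (T z)"] by simp
  also have "ennreal \<kappa> * (\<integral>\<^sup>+z. ennreal (R z) \<partial>lebesgue)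
      + ennreal \<mu> * ((\<integral>\<^sup>+z. ennreal (T z) \<partial>lebesgue) + (\<integral>\<^sup>+z. ennreal (T z) \<partial>lebesgue))
      \<le> ennreal (2 powr (2 * p + 1) * (1 / 4 + c\<^sub>p)) * (\<integral>\<^sup>+z. ennreal (R z) \<partial>lebesgue)
      + ennreal \<mu> * (J + J)"
  proof (intro add_mono mult_mono mult_left_mono ennreal_leI T_le order_refl)
    \<comment> \<open>The Young constant is \<open>2 * c\<^sub>p\<close>, so
      \<open>1 / 2 + 2 * c\<^sub>p\<close> is twice \<open>1 / 4 + c\<^sub>p\<close>. The exponent p
      + 2 is at most 2p + 1 because p > 1.\<close>
    have "\<kappa> = 2 powr (p + 2) * (1 / 4 + c\<^sub>p)"
      by (simp add: \<kappa>_def \<mu>_def c\<^sub>p_def powr_add algebra_simps)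
    also have "\<dots> \<le> 2 powr (2 * p + 1) * (1 / 4 + c\<^sub>p)"
      using p by (intro mult_right_mono powr_mono) (auto simp: c\<^sub>p_def)
    finally show "\<kappa> \<le> 2 powr (2 * p + 1) * (1 / 4 + c\<^sub>p)" .
  qed auto
  also have "ennreal \<mu> * (J + J) = ennreal (2 powr (p + 2)) * J"
  proof -
    have "2 powr (p + 2) = \<mu> + \<mu>" by (simp add: \<mu>_def powr_add)
    then have "ennreal (2 powr (p + 2)) = ennreal \<mu> + ennreal \<mu>"
      using \<mu>1 by (simp only: ennreal_plus)
    then show ?thesis by (simp only: distrib_left distrib_right)
  qed
  finally have final: "ennreal A + (\<integral>\<^sup>+z. ennreal (D z) \<partial>lebesgue)
      \<le> ennreal (2 powr (2 * p + 1) * (1 / 4 + c\<^sub>p)) * (\<integral>\<^sup>+z. ennreal (R z) \<partial>lebesgue)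
        + ennreal (2 powr (p + 2)) * J" .
  have ind: "ennreal (indicator S z * x) = ennreal x * indicator S z" for S x and z :: "(real ^ 'n) \<times> (real ^ 'n)"
    by (simp split: split_indicator)
  have "ereal A + enn2ereal (\<integral>\<^sup>+z. ennreal (D z) \<partial>lebesgue) = enn2ereal (ennreal A + (\<integral>\<^sup>+z. ennreal (D z) \<partial>lebesgue))"
    using A0 by (simp add: plus_ennreal.rep_eq)
  also have "\<dots> \<le> enn2ereal (ennreal (2 powr (2 * p + 1) * (1 / 4 + c\<^sub>p)) * (\<integral>\<^sup>+z. ennreal (R z) \<partial>lebesgue)
        + ennreal (2 powr (p + 2)) * J)"
    using final by (simp add: less_eq_ennreal.rep_eq)
  finally show ?thesis
    unfolding A_def D_def R_def J_def ind by (simp only: mult.assoc)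
qed

end
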